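(* Let $g:\mathbb{R}^m\to\mathbb{R}^l$ be twice continuously differentiable, let $\Theta\subset\mathbb{R}^l$ be a closed convex cone, and let $\Gamma:=g^{-1}(\Theta)$. Let the standing assumptions (A1), (A2), (A3) given in the context be satisfied at some $\bar y\in\Gamma$, and put $\bar u:=\bar y$. Then there is a neighborhood $\mathcal{U}$ of $\bar u$ such that the projection operator $P_\Gamma$ onto $\Gamma$ is single-valued on $\mathcal{U}$ and directionally differentiable at each $u\in\mathcal{U}$ in every direction $h\in\mathbb{R}^m$, and its directional derivative is given by $P'_\Gamma(u;h)=v_1$, where $v_1$ is the first component of the unique solution $v=(v_1,v_2)\in\mathbb{R}^m\times\mathbb{R}^l$ to the system of equations $$h=\Big(I+\sum_{i=1}^l\nu_i\nabla^2g_i(y)\Big)v_1+(\nabla g(y))^Tv_2,$$ $$0=\nabla g(y)v_1-P'_\Theta\big(g(y)+\nu;\,\nabla g(y)v_1+v_2\big),$$ with $y=P_\Gamma(u)$ and $\nu=(\nu_1,\ldots,\nu_l)\in\mathbb{R}^l$ being the unique Lagrange multiplier corresponding to $(u,y)$, i.e., the unique $\nu$ satisfying $$u=y+(\nabla g(y))^T\nu,\qquad 0\in -g(y)+N_{\Theta^*}(\nu).$$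
   Context: Notation: $I$ is the identity matrix; $\nabla g(y)$ is the Jacobian of $g$ at $y$; $P_\Omega$ is the Euclidean metric projection onto a closed set $\Omega$; $f'(x;h)$ is the classical directional derivative of $f$ at $x$ in direction $h$. $\Theta^*:=\{w\mid\langle w,z\rangle\le 0\ \forall z\in\Theta\}$ is the polar cone, and $N_{\Theta^*}$ is the normal cone mapping of convex analysis (empty-valued outside $\Theta^*$). Tangent cone: $T_\Omega(\bar z):=\{z\mid\exists\,t_k\downarrow0,\ z_k\to z\text{ with }\bar z+t_kz_k\in\Omega\}$. Standing assumptions, with $\bar z:=g(\bar y)$: (A1) $\Theta$ is $\mathcal{C}^2$-reducible at $\bar z$ to a closed convex set $\Xi\subset\mathbb{R}^q$, and the reduction is pointed: there exist a neighborhood $V$ of $\bar z$ and a $\mathcal{C}^2$-smooth mapping $\eta:V\to\mathbb{R}^q$ such that for all $z\in V$ one has $z\in\Theta$ if and only if $\eta(z)\in\Xi$, the cone $T_\Xi(\eta(\bar z))$ is pointed, $\eta(\bar z)=0$, and $\nabla\eta(\bar z):\mathbb{R}^l\to\mathbb{R}^q$ is surjective. (A2) $\bar y$ is nondegenerate for $g$ with respect to $\Theta$: $\nabla g(\bar y)\mathbb{R}^m+\operatorname{lin}(T_\Theta(\bar z))=\mathbb{R}^l$, where $\operatorname{lin}(Q)$ denotes the largest linear subspace contained in $Q$. (A3) The metric projection $P_\Theta$ is directionally differentiable on $\mathbb{R}^l$. *)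

theory Defs
  imports "HOL-Analysis.Analysis"
begin

definition C2_on :: "('a::real_normed_vector \<Rightarrow> 'b::real_normed_vector) \<Rightarrow> 'a set \<Rightarrow> bool" where
  "C2_on f S \<longleftrightarrow> open S \<and>
     (\<exists>(f' :: 'a \<Rightarrow> 'a \<Rightarrow>\<^sub>L 'b) (f'' :: 'a \<Rightarrow> 'a \<Rightarrow>\<^sub>L 'a \<Rightarrow>\<^sub>L 'b).
        (\<forall>x\<in>S. (f has_derivative blinfun_apply (f' x)) (at x)) \<and>
        (\<forall>x\<in>S. (f' has_derivative blinfun_apply (f'' x)) (at x)) \<and>
        continuous_on S f'')"

definition gradient :: "(real^'n \<Rightarrow> real) \<Rightarrow> real^'n \<Rightarrow> real^'n" where
  "gradient f x = (\<chi> j. frechet_derivative f (at x) (axis j 1))"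

definition hessian :: "(real^'n \<Rightarrow> real) \<Rightarrow> real^'n \<Rightarrow> real^'n^'n" where
  "hessian f x = jacobian (gradient f) (at x)"

definition has_dir_deriv ::
    "('a::real_normed_vector \<Rightarrow> 'b::real_normed_vector) \<Rightarrow> 'a \<Rightarrow> 'a \<Rightarrow> 'b \<Rightarrow> bool" where
  "has_dir_deriv f x h d \<longleftrightarrow> ((\<lambda>t. (f (x + t *\<^sub>R h) - f x) /\<^sub>R t) \<longlongrightarrow> d) (at_right 0)"

definition dir_differentiable ::
    "('a::real_normed_vector \<Rightarrow> 'b::real_normed_vector) \<Rightarrow> 'a \<Rightarrow> bool" where
  "dir_differentiable f x \<longleftrightarrow> (\<forall>h. \<exists>d. has_dir_deriv f x h d)"

text \<open>Meaningful only where the limit exists.\<close>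
definition dir_deriv ::
    "('a::real_normed_vector \<Rightarrow> 'b::real_normed_vector) \<Rightarrow> 'a \<Rightarrow> 'a \<Rightarrow> 'b" where
  "dir_deriv f x h = Lim (at_right 0) (\<lambda>t. (f (x + t *\<^sub>R h) - f x) /\<^sub>R t)"

text \<open>The set-valued metric projection. Where it is a singleton, its element is
  \<^term>\<open>closest_point S u\<close>, which is an arbitrary choice elsewhere.\<close>
definition metric_projection :: "'a::metric_space set \<Rightarrow> 'a \<Rightarrow> 'a set" where
  "metric_projection S u = {x \<in> S. \<forall>y\<in>S. dist u x \<le> dist u y}"

definition polar_cone :: "'a::real_inner set \<Rightarrow> 'a set" where
  "polar_cone K = {w. \<forall>z\<in>K. w \<bullet> z \<le> 0}"

definition normal_cone :: "'a::real_inner set \<Rightarrow> 'a \<Rightarrow> 'a set" where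
  "normal_cone C x = (if x \<in> C then {w. \<forall>z\<in>C. w \<bullet> (z - x) \<le> 0} else {})"

definition tangent_cone :: "'a::real_normed_vector set \<Rightarrow> 'a \<Rightarrow> 'a set" where
  "tangent_cone S x = {z. \<exists>(t :: nat \<Rightarrow> real) (zs :: nat \<Rightarrow> 'a).
     (\<forall>k. 0 < t k) \<and> t \<longlonglongrightarrow> 0 \<and> zs \<longlonglongrightarrow> z \<and> (\<forall>k. x + t k *\<^sub>R zs k \<in> S)}"

definition pointed :: "'a::real_vector set \<Rightarrow> bool" where
  "pointed K \<longleftrightarrow> K \<inter> uminus ` K = {0}"

text \<open>The largest linear subspace contained in \<open>Q\<close>; it exists when \<open>Q\<close> is a convex cone
  containing 0.\<close>
definition lin :: "'a::real_vector set \<Rightarrow> 'a set" where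
  "lin Q = (GREATEST L. subspace L \<and> L \<subseteq> Q)"

text \<open>The reduction space is a linear subspace \<open>E\<close> of \<^typ>\<open>real^'q\<close> instead of the whole
  space, because the type \<^typ>\<open>real^'q\<close> never has dimension 0. The choice \<open>E = UNIV\<close>
  is the usual case; \<open>E = {0}\<close> is the case of reduction dimension 0, which occurs
  when \<open>z\<close> is an interior point of \<open>Theta\<close>.\<close>
definition pointed_C2_reducible ::
    "(real^'l) set \<Rightarrow> real^'l \<Rightarrow> (real^'q) set \<Rightarrow> (real^'q) set \<Rightarrow> bool" where
  "pointed_C2_reducible Theta z E Xi \<longleftrightarrow>
     subspace E \<and> Xi \<subseteq> E \<and> closed Xi \<and> convex Xi \<and>
     (\<exists>V \<eta>. open V \<and> z \<in> V \<and> C2_on \<eta> V \<and> \<eta> ` V \<subseteq> E \<and>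
        (\<forall>x\<in>V. x \<in> Theta \<longleftrightarrow> \<eta> x \<in> Xi) \<and>
        pointed (tangent_cone Xi (\<eta> z)) \<and>
        \<eta> z = 0 \<and>
        range ((*v) (jacobian \<eta> (at z))) = E)"

definition nondegenerate :: "(real^'m \<Rightarrow> real^'l) \<Rightarrow> (real^'l) set \<Rightarrow> real^'m \<Rightarrow> bool" where
  "nondegenerate g Theta y \<longleftrightarrow>
     {a + b | a b. a \<in> range ((*v) (jacobian g (at y))) \<and> b \<in> lin (tangent_cone Theta (g y))} = UNIV"

definition lagrange_multiplier ::
    "(real^'m \<Rightarrow> real^'l) \<Rightarrow> (real^'l) set \<Rightarrow> real^'m \<Rightarrow> real^'m \<Rightarrow> real^'l \<Rightarrow> bool" where
  "lagrange_multiplier g Theta u y \<nu> \<longleftrightarrow>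
     u = y + transpose (jacobian g (at y)) *v \<nu> \<and>
     0 \<in> (\<lambda>w. - g y + w) ` normal_cone (polar_cone Theta) \<nu>"

definition derivative_system ::
    "(real^'m \<Rightarrow> real^'l) \<Rightarrow> (real^'l) set \<Rightarrow> real^'m \<Rightarrow> real^'l \<Rightarrow> real^'m \<Rightarrow>
      (real^'m) \<times> (real^'l) \<Rightarrow> bool" where
  "derivative_system g Theta y \<nu> h = (\<lambda>(v1, v2).
     h = (mat 1 + (\<Sum>i\<in>UNIV. (\<nu> $ i) *\<^sub>R hessian (\<lambda>x. g x $ i) y)) *v v1
           + transpose (jacobian g (at y)) *v v2 \<and>
     0 = jacobian g (at y) *v v1
           - dir_deriv (closest_point Theta) (g y + \<nu>) (jacobian g (at y) *v v1 + v2))"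

end

theory Submission
  imports Defs
begin

text \<open>
  Write \<open>A = g' y\<close> and let \<open>\<eta>\<close> be the reduction of \<open>Theta\<close> to \<open>Xi\<close>. Because the tangent cone
  of \<open>Xi\<close> is pointed, the lineality space of the tangent cone of \<open>Theta\<close> at \<open>g ybar\<close> is the
  kernel of \<open>\<eta>'\<close> (lemma \<open>lin_tangent_cone\<close>), so nondegeneracy says that the derivative of
  \<open>\<eta> \<circ> g\<close> at \<open>ybar\<close> maps onto \<open>E\<close>. This persists nearby with uniform constants
  (\<open>uniformly_onto_nearby\<close>), and near \<open>ybar\<close> the set \<open>Gamma\<close> is the preimage of the convex set
  \<open>Xi\<close> under \<open>\<eta> \<circ> g\<close>.

  Let \<open>u\<close> be near \<open>ybar\<close> and let \<open>y\<close> be a closest point of \<open>Gamma\<close>. Then \<open>y\<close> is near \<open>ybar\<close>,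
  and the inverse function theorem yields a multiplier \<open>\<nu>\<close>, normal to \<open>Theta\<close> at \<open>g y\<close>, with
  \<open>u - y = A\<^sup>T \<nu>\<close> (\<open>proximal_normal_multiplier\<close>, \<open>multiplier_exists\<close>); it is unique and its norm
  is at most a constant times that of \<open>u - y\<close>. Normals of a convex set are monotone, so the
  second-order Taylor estimate for \<open>g\<close> and the smallness of the multipliers show that \<open>y\<close> depends
  on \<open>u\<close> in a Lipschitz way (\<open>projection_lipschitz\<close>). This gives single-valuedness; the multiplier
  is Lipschitz in \<open>u\<close> as well (\<open>multiplier_lipschitz\<close>).

  For the derivative in direction \<open>h\<close>, consider the difference quotients of \<open>y\<close> and \<open>\<nu>\<close> at
  \<open>u + t h\<close>. They are bounded, and every cluster point \<open>(v1, v2)\<close> as \<open>t\<close> tends to 0 solves the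
  linearized system (\<open>limit_solves\<close>): the first equation comes from linearizing
  \<open>u = y + A\<^sup>T \<nu>\<close>, the second from \<open>g y = P (g y + \<nu>)\<close>, where \<open>P\<close> is the projection onto
  \<open>Theta\<close>, together with the nonexpansiveness of \<open>P\<close>.

  The system has at most one solution (\<open>solves_unique\<close>). Monotonicity of the directional derivative
  of \<open>P\<close> and smallness of \<open>\<nu>\<close> make the difference of the first components vanish. The difference
  of the second components is then orthogonal to the range of \<open>A\<close>, and it is orthogonal to the
  kernel of \<open>\<eta>' (g y)\<close> because two directions with the same directional derivative of \<open>P\<close> differ
  by a vector orthogonal to that kernel (\<open>dir_deriv_closest_point_tangential\<close>). Nondegeneracy
  makes it zero. A bounded family with exactly one possible cluster point converges, which gives
  both the derivative and the solvability of the system.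

  Adjoint maps are avoided: \<open>u - y = A\<^sup>T \<nu>\<close> is stated by testing with every vector \<open>v\<close>, as
  \<open>(u - y) \<bullet> v = \<nu> \<bullet> A v\<close>.
\<close>

section \<open>Difference quotients\<close>

lemma tendsto_of_quotient_tendsto:
  fixes X :: "'i \<Rightarrow> 'a::real_normed_vector"
  assumes tau: "(\<tau> \<longlongrightarrow> 0) F" and pos: "\<forall>\<^sub>F k in F. 0 < \<tau> k"
    and q: "((\<lambda>k. (X k - x) /\<^sub>R \<tau> k) \<longlongrightarrow> v) F"
  shows "(X \<longlongrightarrow> x) F"
proof -
  have "((\<lambda>k. \<tau> k *\<^sub>R ((X k - x) /\<^sub>R \<tau> k) + x) \<longlongrightarrow> 0 *\<^sub>R v + x) F"
    by (intro tendsto_intros tau q)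
  moreover have "\<forall>\<^sub>F k in F. \<tau> k *\<^sub>R ((X k - x) /\<^sub>R \<tau> k) + x = X k"
    using pos by eventually_elim simp
  ultimately show ?thesis
    using tendsto_cong[of "\<lambda>k. \<tau> k *\<^sub>R ((X k - x) /\<^sub>R \<tau> k) + x" X F] by simp
qed

lemma difference_quotient_tendsto:
  fixes f :: "'a::real_normed_vector \<Rightarrow> 'b::real_normed_vector"
  assumes f: "(f has_derivative f') (at x)"
    and tau: "(\<tau> \<longlongrightarrow> 0) F" and pos: "\<forall>\<^sub>F k in F. 0 < \<tau> k"
    and q: "((\<lambda>k. (X k - x) /\<^sub>R \<tau> k) \<longlongrightarrow> v) F"
  shows "((\<lambda>k. (f (X k) - f x) /\<^sub>R \<tau> k) \<longlongrightarrow> f' v) F"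
proof -
  have lin: "bounded_linear f'"
    using f by (rule has_derivative_bounded_linear)
  have X: "((\<lambda>k. X k - x) \<longlongrightarrow> 0) F"
    using tendsto_of_quotient_tendsto[OF tau pos q] by (rule LIM_zero)
  define M where "M = norm v + 1"
  have M: "M > 0" unfolding M_def by (simp add: add_nonneg_pos)
  have qM: "\<forall>\<^sub>F k in F. norm ((X k - x) /\<^sub>R \<tau> k) < M"
    using order_tendstoD(2)[OF tendsto_norm[OF q], of M] unfolding M_def by simp
  have rem: "((\<lambda>k. (f (X k) - f x - f' (X k - x)) /\<^sub>R \<tau> k) \<longlongrightarrow> 0) F"
  proof (rule tendstoI)
    fix e :: real assume e: "e > 0"
    obtain d where d: "d > 0"
      "\<And>y. norm (y - x) < d \<Longrightarrow> norm (f y - f x - f' (y - x)) \<le> (e / M) * norm (y - x)"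
      using f[unfolded has_derivative_at_alt] e M by (metis divide_pos_pos)
    have "\<forall>\<^sub>F k in F. norm (X k - x) < d"
      using order_tendstoD(2)[OF tendsto_norm[OF X], of d] d(1) by simp
    then show "\<forall>\<^sub>F k in F. dist ((f (X k) - f x - f' (X k - x)) /\<^sub>R \<tau> k) 0 < e"
      using pos qM
    proof eventually_elim
      case (elim k)
      have "norm ((f (X k) - f x - f' (X k - x)) /\<^sub>R \<tau> k) \<le> ((e / M) * norm (X k - x)) / \<tau> k"
        using d(2)[OF elim(1)] elim(2) by (simp add: divide_inverse_commute divide_right_mono)
      also have "\<dots> = (e / M) * norm ((X k - x) /\<^sub>R \<tau> k)"
        using elim(2) by (simp add: divide_inverse_commute)
      also have "\<dots> < (e / M) * M"
        using elim(3) e M by (intro mult_strict_left_mono) auto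
      finally show ?case using M by simp
    qed
  qed
  have "((\<lambda>k. (f (X k) - f x - f' (X k - x)) /\<^sub>R \<tau> k + f' ((X k - x) /\<^sub>R \<tau> k)) \<longlongrightarrow> 0 + f' v) F"
    by (intro tendsto_add rem bounded_linear.tendsto[OF lin] q)
  then show ?thesis
    using lin by (simp add: linear_simps scaleR_diff_right)
qed

lemma directional_quotient_tendsto:
  fixes f :: "'a::real_normed_vector \<Rightarrow> 'b::real_normed_vector"
  assumes "(f has_derivative f') (at x)"
  shows "((\<lambda>t. (f (x + t *\<^sub>R v) - f x) /\<^sub>R t) \<longlongrightarrow> f' v) (at_right 0)"
proof (rule difference_quotient_tendsto[OF assms])
  show "\<forall>\<^sub>F t in at_right (0::real). 0 < t" by (simp add: eventually_at_right_less)
  have "\<forall>\<^sub>F t in at_right (0::real). (x + t *\<^sub>R v - x) /\<^sub>R t = v"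
    using eventually_at_right_less[of "0::real"] by eventually_elim simp
  then show "((\<lambda>t. (x + t *\<^sub>R v - x) /\<^sub>R t) \<longlongrightarrow> v) (at_right (0::real))"
    by (rule tendsto_eventually)
qed simp

text \<open>A function that is bounded near \<open>0\<close> from the right and whose sequential limits there all
  satisfy a property \<open>P\<close> with at most one solution converges. In particular \<open>P\<close> has a solution.\<close>
lemma tendsto_at_right_unique_cluster:
  fixes Q :: "real \<Rightarrow> 'a::euclidean_space"
  assumes bdd: "\<forall>\<^sub>F t in at_right 0. norm (Q t) \<le> R"
    and cluster: "\<And>T v. (\<And>k. 0 < T k) \<Longrightarrow> T \<longlonglongrightarrow> 0 \<Longrightarrow> (\<lambda>k. Q (T k)) \<longlonglongrightarrow> v \<Longrightarrow> P v"
    and uniq: "\<And>v v'. P v \<Longrightarrow> P v' \<Longrightarrow> v = v'"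
  shows "\<exists>v. P v \<and> (Q \<longlongrightarrow> v) (at_right 0)"
proof -
  obtain \<delta> where \<delta>: "\<delta> > 0" "\<And>t. 0 < t \<Longrightarrow> t < \<delta> \<Longrightarrow> norm (Q t) \<le> R"
    using bdd unfolding eventually_at_right_field by auto
  have sub: "\<exists>v r. strict_mono (r :: nat \<Rightarrow> nat) \<and> P v \<and> (\<lambda>k. Q (T (r k))) \<longlonglongrightarrow> v"
    if T: "\<And>k. 0 < T k" "\<And>k. T k < \<delta> / real (Suc k)" for T
  proof -
    have T\<delta>: "T k < \<delta>" for k
    proof -
      have "\<delta> / real (Suc k) \<le> \<delta> / 1"
        using \<delta>(1) by (intro divide_left_mono) auto
      then show ?thesis using T(2)[of k] by simp
    qed
    have "(\<lambda>k. \<delta> / real (Suc k)) \<longlonglongrightarrow> 0"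
      using LIMSEQ_Suc[OF lim_const_over_n[of \<delta>]] by simp
    then have T0: "T \<longlonglongrightarrow> 0"
    proof (rule tendsto_sandwich[OF _ _ tendsto_const, rotated 2])
      show "\<forall>\<^sub>F k in sequentially. 0 \<le> T k"
        using T(1) by (simp add: less_imp_le)
      show "\<forall>\<^sub>F k in sequentially. T k \<le> \<delta> / real (Suc k)"
        using T(2) less_imp_le by (intro always_eventually) blast
    qed
    have "\<forall>k. Q (T k) \<in> cball 0 R"
      using \<delta>(2) T(1) T\<delta> by auto
    then obtain v r where r: "strict_mono (r :: nat \<Rightarrow> nat)" "((\<lambda>k. Q (T k)) \<circ> r) \<longlonglongrightarrow> v"
      using compact_cball[of "0::'a" R, unfolded compact_def, rule_format, of "\<lambda>k. Q (T k)"] by blast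
    have "P v"
      by (rule cluster[of "T \<circ> r"]) (use T(1) r LIMSEQ_subseq_LIMSEQ[OF T0 r(1)] in \<open>auto simp: o_def\<close>)
    then show ?thesis using r by (auto simp: o_def)
  qed
  have half: "0 < \<delta> / (2 * real (Suc k))" "\<delta> / (2 * real (Suc k)) < \<delta> / real (Suc k)" for k
    using \<delta>(1) by (auto intro!: divide_pos_pos divide_strict_left_mono simp: add_pos_nonneg)
  obtain v where v: "P v"
    using sub[of "\<lambda>k. \<delta> / (2 * real (Suc k))", OF half] by blast
  have "(Q \<longlongrightarrow> v) (at_right 0)"
  proof (rule ccontr)
    assume "\<not> (Q \<longlongrightarrow> v) (at_right 0)"
    then obtain e where e: "e > 0" "\<not> (\<forall>\<^sub>F t in at_right 0. dist (Q t) v < e)"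
      unfolding tendsto_iff by blast
    have "\<exists>t. 0 < t \<and> t < \<delta> / real (Suc k) \<and> e \<le> dist (Q t) v" for k
    proof -
      have "0 < \<delta> / real (Suc k)" using \<delta>(1) by simp
      then show ?thesis
        using e(2) unfolding eventually_at_right_field by (meson not_less)
    qed
    then have "\<forall>k. \<exists>t. 0 < t \<and> t < \<delta> / real (Suc k) \<and> e \<le> dist (Q t) v" by blast
    from choice[OF this] obtain T where
      T: "\<And>k. 0 < T k" "\<And>k. T k < \<delta> / real (Suc k)" "\<And>k. e \<le> dist (Q (T k)) v"
      by blast
    obtain v' r where r: "strict_mono (r :: nat \<Rightarrow> nat)" "P v'" "(\<lambda>k. Q (T (r k))) \<longlonglongrightarrow> v'"
      using sub[OF T(1,2)] by blast
    have "(\<lambda>k. Q (T (r k))) \<longlonglongrightarrow> v" using r(3) unfolding uniq[OF r(2) v] .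
    then have "(\<lambda>k. dist (Q (T (r k))) v) \<longlonglongrightarrow> 0" by (rule iffD1[OF tendsto_dist_iff])
    then have "e \<le> 0"
      by (rule tendsto_lowerbound) (auto intro: always_eventually T(3))
    then show False using e(1) by simp
  qed
  then show ?thesis using v by blast
qed

lemma has_dir_deriv_iff:
  assumes "has_dir_deriv f x h d"
  shows "has_dir_deriv f x h p \<longleftrightarrow> p = dir_deriv f x h"
proof -
  have "dir_deriv f x h = d"
    using assms unfolding has_dir_deriv_def dir_deriv_def by (rule tendsto_Lim[OF trivial_limit_at_right_real])
  then show ?thesis
    using assms unfolding has_dir_deriv_def by (metis tendsto_unique[OF trivial_limit_at_right_real])
qed

section \<open>Local bounds for twice continuously differentiable maps\<close>

lemma norm_le_of_inner_le:
  fixes a :: "'a::real_inner"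
  assumes "\<And>v. a \<bullet> v \<le> b * norm v" "b \<ge> 0"
  shows "norm a \<le> b"
proof (cases "a = 0")
  case False
  then show ?thesis
    using assms(1)[of a] by (simp add: dot_square_norm power2_eq_square)
qed (use assms in simp)

lemma abs_inner_le_mult:
  fixes a b :: "'a::real_inner"
  assumes "norm a \<le> A" "norm b \<le> B"
  shows "\<bar>a \<bullet> b\<bar> \<le> A * B"
  using Cauchy_Schwarz_ineq2[of a b] mult_mono[OF assms] assms(1) norm_ge_zero[of a] norm_ge_zero[of b]
  by linarith

lemma norm_blinfun_le_mult:
  assumes "norm f \<le> K" shows "norm (blinfun_apply f v) \<le> K * norm v"
  using norm_blinfun[of f v] mult_right_mono[OF assms, of "norm v"] by simp

text \<open>The map \<open>f\<close> has first and second derivatives \<open>f'\<close> and \<open>f''\<close> on \<open>S\<close>, and one constant \<open>K\<close>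
  serves as a bound for both, as a Lipschitz constant of \<open>f\<close> and \<open>f'\<close>, and in the second-order
  Taylor estimate.\<close>
definition second_order_bounds ::
    "('a::real_normed_vector \<Rightarrow> 'b::real_normed_vector) \<Rightarrow> ('a \<Rightarrow> 'a \<Rightarrow>\<^sub>L 'b) \<Rightarrow>
      ('a \<Rightarrow> 'a \<Rightarrow>\<^sub>L 'a \<Rightarrow>\<^sub>L 'b) \<Rightarrow> 'a set \<Rightarrow> real \<Rightarrow> bool" where
  "second_order_bounds f f' f'' S K \<longleftrightarrow>
     (\<forall>x\<in>S. (f has_derivative f' x) (at x) \<and> (f' has_derivative f'' x) (at x) \<and>
            norm (f' x) \<le> K \<and> norm (f'' x) \<le> K) \<and>
     (\<forall>x\<in>S. \<forall>x'\<in>S. norm (f x - f x') \<le> K * norm (x - x') \<and>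
            norm (f' x - f' x') \<le> K * norm (x - x') \<and>
            norm (f x - f x' - f' x' (x - x')) \<le> K * (norm (x - x'))\<^sup>2)"

lemma second_order_bounds_mono:
  assumes "second_order_bounds f f' f'' S K" "T \<subseteq> S" "K \<le> K'"
  shows "second_order_bounds f f' f'' T K'"
  unfolding second_order_bounds_def
proof (intro conjI ballI)
  fix x assume x: "x \<in> T"
  with assms show "(f has_derivative f' x) (at x)" "(f' has_derivative f'' x) (at x)"
    "norm (f' x) \<le> K'" "norm (f'' x) \<le> K'"
    unfolding second_order_bounds_def by force+
  fix x' assume x': "x' \<in> T"
  have "K * norm (x - x') \<le> K' * norm (x - x')" "K * (norm (x - x'))\<^sup>2 \<le> K' * (norm (x - x'))\<^sup>2"
    using assms(3) by (auto intro: mult_right_mono)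
  then show "norm (f x - f x') \<le> K' * norm (x - x')"
      "norm (f' x - f' x') \<le> K' * norm (x - x')"
      "norm (f x - f x' - f' x' (x - x')) \<le> K' * (norm (x - x'))\<^sup>2"
    using assms(1,2) x x' unfolding second_order_bounds_def by (meson order_trans subsetD)+
qed

lemma second_order_bounds_exist:
  fixes f :: "'a::euclidean_space \<Rightarrow> 'b::real_normed_vector"
  assumes S: "open S" "y \<in> S"
    and d1: "\<And>x. x \<in> S \<Longrightarrow> (f has_derivative blinfun_apply (f' x)) (at x)"
    and d2: "\<And>x. x \<in> S \<Longrightarrow> (f' has_derivative blinfun_apply (f'' x)) (at x)"
    and cont: "continuous_on S f''"
  shows "\<exists>r>0. \<exists>K>0. cball y r \<subseteq> S \<and> second_order_bounds f f' f'' (cball y r) K"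
proof -
  obtain r where r: "r > 0" "cball y r \<subseteq> S"
    using S open_contains_cball by blast
  have "continuous_on S f'"
    using d2 by (meson has_derivative_continuous continuous_at_imp_continuous_on)
  then have cpt: "compact (f' ` cball y r)" "compact (f'' ` cball y r)"
    using cont r(2) by (meson compact_cball compact_continuous_image continuous_on_subset)+
  have b1: "bounded (f' ` cball y r)" and b2: "bounded (f'' ` cball y r)"
    using cpt compact_imp_bounded by blast+
  obtain K1 where K1: "K1 > 0" "\<And>x. x \<in> cball y r \<Longrightarrow> norm (f' x) \<le> K1"
    using b1 unfolding bounded_pos by blast
  obtain K2 where K2: "K2 > 0" "\<And>x. x \<in> cball y r \<Longrightarrow> norm (f'' x) \<le> K2"
    using b2 unfolding bounded_pos by blast
  have lip0: "norm (f x - f x') \<le> K1 * norm (x - x')"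
    if "x \<in> cball y r" "x' \<in> cball y r" for x x'
  proof (rule differentiable_bound[of "cball y r" f "\<lambda>x. blinfun_apply (f' x)"])
    show "(f has_derivative blinfun_apply (f' x)) (at x within cball y r)"
      if "x \<in> cball y r" for x
      using d1 r(2) that has_derivative_at_withinI by blast
    show "onorm (blinfun_apply (f' x)) \<le> K1" if "x \<in> cball y r" for x
      using K1(2)[OF that] by (simp add: norm_blinfun.rep_eq)
  qed (use that in auto)
  have lip: "norm (f' x - f' x') \<le> K2 * norm (x - x')"
    if "x \<in> cball y r" "x' \<in> cball y r" for x x'
  proof (rule differentiable_bound[of "cball y r" f' "\<lambda>x. blinfun_apply (f'' x)"])
    show "(f' has_derivative blinfun_apply (f'' x)) (at x within cball y r)"
      if "x \<in> cball y r" for x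
      using d2 r(2) that has_derivative_at_withinI by blast
    show "onorm (blinfun_apply (f'' x)) \<le> K2" if "x \<in> cball y r" for x
      using K2(2)[OF that] by (simp add: norm_blinfun.rep_eq)
  qed (use that in auto)
  have taylor: "norm (f x - f x' - f' x' (x - x')) \<le> K2 * (norm (x - x'))\<^sup>2"
    if x: "x \<in> cball y r" and x': "x' \<in> cball y r" for x x'
  proof -
    have seg: "closed_segment x' x \<subseteq> cball y r"
      using x x' by (simp add: closed_segment_subset)
    have "norm (f x - f x' - f' x' (x - x')) \<le> norm (x - x') * (K2 * norm (x - x'))"
    proof (rule differentiable_bound_linearization[where S="closed_segment x' x"
          and f'="\<lambda>x. blinfun_apply (f' x)"])
      show "x' + t *\<^sub>R (x - x') \<in> closed_segment x' x" if "t \<in> {0..1}" for t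
        using that by (auto simp: in_segment algebra_simps intro!: exI[of _ t])
      show "(f has_derivative blinfun_apply (f' z)) (at z within closed_segment x' x)"
        if "z \<in> closed_segment x' x" for z
        using d1 r(2) that seg has_derivative_at_withinI by blast
      show "onorm (blinfun_apply (f' z) - blinfun_apply (f' x')) \<le> K2 * norm (x - x')"
        if z: "z \<in> closed_segment x' x" for z
      proof -
        have "norm (f' z - f' x') \<le> K2 * norm (z - x')"
          using lip[of z x'] seg z x' by blast
        also have "\<dots> \<le> K2 * norm (x - x')"
          using segment_bound1[OF z] K2(1) by simp
        finally show ?thesis
          by (simp add: norm_blinfun.rep_eq minus_blinfun.rep_eq fun_diff_def)
      qed
    qed auto
    then show ?thesis by (simp add: power2_eq_square algebra_simps)
  qed
  have mono: "K1 * t \<le> max K1 K2 * t" "K2 * t \<le> max K1 K2 * t" if "t \<ge> 0" for t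
    using that by (simp_all add: mult_right_mono)
  have "second_order_bounds f f' f'' (cball y r) (max K1 K2)"
    unfolding second_order_bounds_def
    using d1 d2 r(2) K1(2) K2(2) lip0 lip taylor mono
    by (meson max.coboundedI1 max.coboundedI2 norm_ge_zero order_trans subsetD zero_le_power2)
  then show ?thesis using r K1(1) by (metis less_max_iff_disj)
qed

section \<open>Constraint maps with surjective derivative\<close>

text \<open>If \<open>G\<close> maps into the range of its derivative \<open>B = G' y\<close>, then every direction \<open>d\<close> is the
  velocity at \<open>y\<close> of a curve along which \<open>G\<close> is exactly affine. With a right inverse \<open>L\<close> of \<open>B\<close>, the map
  \<open>F x = L (G x) + x - L (B x)\<close> has the identity as derivative at \<open>y\<close> and satisfies \<open>B (F x) = G x\<close>.
  The curve is the preimage of a straight line under \<open>F\<close>.\<close>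
lemma curve_in_direction:
  fixes G :: "'a::euclidean_space \<Rightarrow> 'b::euclidean_space"
  assumes V: "open V" "y \<in> V"
    and der: "\<And>x. x \<in> V \<Longrightarrow> (G has_derivative blinfun_apply (G' x)) (at x)"
    and cont: "continuous_on V G'"
    and E: "G ` V \<subseteq> range (G' y)"
  shows "\<exists>\<delta>>0. \<exists>c. c 0 = y \<and> (c has_vector_derivative d) (at 0) \<and>
           (\<forall>t. \<bar>t\<bar> < \<delta> \<longrightarrow> c t \<in> V \<and> G (c t) = G y + t *\<^sub>R G' y d)"
proof -
  define B where "B = G' y"
  obtain L where L: "linear L" "\<And>e. e \<in> range B \<Longrightarrow> B (L e) = e"
    using linear_exists_right_inverse_on[of "blinfun_apply B" UNIV]
    by (auto simp: blinfun.bounded_linear_right bounded_linear.linear)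
  define Lb where "Lb = Blinfun L"
  have Lb: "blinfun_apply Lb = L"
    unfolding Lb_def using L(1) by (simp add: bounded_linear_Blinfun_apply linear_conv_bounded_linear)
  define F where "F x = Lb (G x) + x - Lb (B x)" for x
  define F' where "F' x = (Lb o\<^sub>L G' x) + id_blinfun - (Lb o\<^sub>L B)" for x
  have F': "(F has_derivative blinfun_apply (F' x)) (at x)" if "x \<in> V" for x
    unfolding F_def[abs_def] F'_def
    by (rule has_derivative_eq_rhs, (rule derivative_intros der that)+)
       (auto simp: blinfun.bilinear_simps)
  have contF: "continuous_on V F'"
    unfolding F'_def by (intro continuous_intros cont)
  have id: "id_blinfun o\<^sub>L F' y = id_blinfun"
    unfolding F'_def B_def by (auto intro!: blinfun_eqI simp: blinfun.bilinear_simps)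
  have BF: "B (F x) = G x" if "x \<in> V" for x
    using L(2)[of "G x"] L(2)[of "B x"] E that unfolding F_def B_def[symmetric]
    by (auto simp: blinfun.bilinear_simps Lb)
  obtain U' W \<phi> \<phi>' where W: "open U'" "U' \<subseteq> V" "y \<in> U'" "open W" "F y \<in> W" "homeomorphism U' W F \<phi>"
    "\<And>z. z \<in> W \<Longrightarrow> (\<phi> has_derivative (\<phi>' z)) (at z)"
    "\<And>z. z \<in> W \<Longrightarrow> \<phi>' z = inv (blinfun_apply (F' (\<phi> z)))"
    "\<And>z. z \<in> W \<Longrightarrow> bij (blinfun_apply (F' (\<phi> z)))"
    using inverse_function_theorem[OF V(1) F' contF V(2) id] by metis
  have \<phi>y: "\<phi> (F y) = y"
    using W(3,6) by (simp add: homeomorphism_apply1)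
  have F'y: "F' y = id_blinfun"
    unfolding F'_def B_def by (auto intro!: blinfun_eqI simp: blinfun.bilinear_simps)
  have \<phi>': "\<phi>' (F y) = id"
    using W(8)[OF W(5)] unfolding \<phi>y F'y by (simp add: id_blinfun.rep_eq id_def[symmetric])
  define c where "c t = \<phi> (F y + t *\<^sub>R d)" for t
  have c0: "c 0 = y" unfolding c_def using \<phi>y by simp
  have "((\<lambda>t. F y + t *\<^sub>R d) has_derivative (\<lambda>t. t *\<^sub>R d)) (at 0)"
    by (auto intro!: derivative_eq_intros)
  moreover have "(\<phi> has_derivative id) (at (F y + 0 *\<^sub>R d))"
    using W(7)[OF W(5)] \<phi>' by simp
  ultimately have "(\<phi> \<circ> (\<lambda>t. F y + t *\<^sub>R d) has_derivative id \<circ> (\<lambda>t. t *\<^sub>R d)) (at 0)"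
    by (rule diff_chain_at)
  then have dc: "(c has_vector_derivative d) (at 0)"
    unfolding has_vector_derivative_def c_def[abs_def] by (simp add: o_def)
  have "open ((\<lambda>t. F y + t *\<^sub>R d) -` W)"
    by (intro open_vimage W(4) continuous_intros)
  then obtain \<delta> where \<delta>: "\<delta> > 0" "ball 0 \<delta> \<subseteq> (\<lambda>t. F y + t *\<^sub>R d) -` W"
    using W(5) unfolding open_contains_ball by force
  have "c t \<in> V \<and> G (c t) = G y + t *\<^sub>R B d" if "\<bar>t\<bar> < \<delta>" for t
  proof -
    have tW: "F y + t *\<^sub>R d \<in> W"
      using \<delta>(2) that by (auto simp: subset_iff dist_norm)
    have cU: "c t \<in> U'" "F (c t) = F y + t *\<^sub>R d"
      unfolding c_def using tW W(6) by (auto simp: homeomorphism_def)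
    then have "G (c t) = B (F y + t *\<^sub>R d)"
      using BF W(2) by force
    then show ?thesis
      using cU(1) W(2) BF[OF V(2)] by (auto simp: blinfun.bilinear_simps)
  qed
  then show ?thesis
    using \<delta>(1) c0 dc unfolding B_def by blast
qed

text \<open>The inequality assumed of \<open>w\<close> says that \<open>w\<close> is a proximal normal of \<open>S\<close> at \<open>y\<close>. With
  \<open>\<kappa> = 0\<close> it describes the normals of a convex set, and with \<open>\<kappa> = 1/2\<close> it holds for \<open>w = u - y\<close>
  when \<open>y\<close> is a closest point of \<open>S\<close> to \<open>u\<close>.\<close>
lemma proximal_normal_curve:
  fixes G :: "'a::euclidean_space \<Rightarrow> 'b::euclidean_space"
  assumes V: "open V" "y \<in> V"
    and der: "\<And>x. x \<in> V \<Longrightarrow> (G has_derivative blinfun_apply (G' x)) (at x)"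
    and cont: "continuous_on V G'"
    and E: "G ` V \<subseteq> range (G' y)"
    and S: "\<And>x. x \<in> V \<Longrightarrow> x \<in> S \<longleftrightarrow> G x \<in> \<Xi>"
    and w: "\<And>x. x \<in> S \<Longrightarrow> w \<bullet> (x - y) \<le> \<kappa> * (norm (x - y))\<^sup>2"
    and d: "\<And>t. 0 < t \<Longrightarrow> t < 1 \<Longrightarrow> G y + t *\<^sub>R G' y d \<in> \<Xi>"
  shows "w \<bullet> d \<le> 0"
proof -
  obtain \<delta> c where \<delta>: "\<delta> > 0" and c0: "c 0 = y" and dc: "(c has_vector_derivative d) (at 0)"
    and c: "\<And>t. \<bar>t\<bar> < \<delta> \<Longrightarrow> c t \<in> V \<and> G (c t) = G y + t *\<^sub>R G' y d"
    using curve_in_direction[OF V der cont E] by metis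
  have "((\<lambda>t. (c (0 + t *\<^sub>R 1) - c 0) /\<^sub>R t) \<longlongrightarrow> 1 *\<^sub>R d) (at_right 0)"
    by (rule directional_quotient_tendsto[OF dc[unfolded has_vector_derivative_def]])
  then have q: "((\<lambda>t. (c t - y) /\<^sub>R t) \<longlongrightarrow> d) (at_right 0)"
    using c0 by simp
  have "((\<lambda>t. \<kappa> * t * (norm ((c t - y) /\<^sub>R t))\<^sup>2) \<longlongrightarrow> \<kappa> * 0 * (norm d)\<^sup>2) (at_right 0)"
    by (intro tendsto_intros q)
  then have "((\<lambda>t. \<kappa> * t * (norm ((c t - y) /\<^sub>R t))\<^sup>2) \<longlongrightarrow> 0) (at_right 0)" by simp
  moreover have "((\<lambda>t. w \<bullet> ((c t - y) /\<^sub>R t)) \<longlongrightarrow> w \<bullet> d) (at_right 0)"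
    by (intro tendsto_intros q)
  moreover have "\<forall>\<^sub>F t in at_right 0. w \<bullet> ((c t - y) /\<^sub>R t) \<le> \<kappa> * t * (norm ((c t - y) /\<^sub>R t))\<^sup>2"
    unfolding eventually_at_right_field
  proof (intro exI[of _ "min \<delta> 1"] conjI allI impI)
    fix t :: real assume t: "0 < t" "t < min \<delta> 1"
    then have "c t \<in> S" using c[of t] S d[of t] by auto
    from w[OF this] have "w \<bullet> (c t - y) / t \<le> \<kappa> * (norm (c t - y))\<^sup>2 / t"
      using t by (simp add: divide_right_mono)
    moreover have "\<kappa> * t * (norm ((c t - y) /\<^sub>R t))\<^sup>2 = \<kappa> * (norm (c t - y))\<^sup>2 / t"
    proof -
      have n: "norm ((c t - y) /\<^sub>R t) = norm (c t - y) / t"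
        using t by (simp add: divide_inverse_commute)
      show ?thesis unfolding n using t by (simp add: power2_eq_square)
    qed
    moreover have "w \<bullet> ((c t - y) /\<^sub>R t) = w \<bullet> (c t - y) / t"
      by (simp add: divide_inverse_commute)
    ultimately show "w \<bullet> ((c t - y) /\<^sub>R t) \<le> \<kappa> * t * (norm ((c t - y) /\<^sub>R t))\<^sup>2"
      by (simp only:)
  qed (use \<delta> in auto)
  ultimately show ?thesis
    using tendsto_le[OF trivial_limit_at_right_real] by blast
qed

text \<open>Proximal normals of the preimage of a convex set are images of normals of that set under
  the transposed derivative.\<close>
lemma proximal_normal_multiplier:
  fixes G :: "'a::euclidean_space \<Rightarrow> 'b::euclidean_space"
  assumes V: "open V" "y \<in> V"
    and der: "\<And>x. x \<in> V \<Longrightarrow> (G has_derivative blinfun_apply (G' x)) (at x)"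
    and cont: "continuous_on V G'"
    and E: "subspace E" "G ` V \<subseteq> E" "range (G' y) = E"
    and S: "\<And>x. x \<in> V \<Longrightarrow> x \<in> S \<longleftrightarrow> G x \<in> \<Xi>"
    and \<Xi>: "convex \<Xi>" "\<Xi> \<subseteq> E" and y: "y \<in> S"
    and w: "\<And>x. x \<in> S \<Longrightarrow> w \<bullet> (x - y) \<le> \<kappa> * (norm (x - y))\<^sup>2"
  shows "\<exists>\<mu>\<in>E. (\<forall>v. w \<bullet> v = \<mu> \<bullet> G' y v) \<and> (\<forall>\<xi>\<in>\<Xi>. \<mu> \<bullet> (\<xi> - G y) \<le> 0)"
proof -
  have G\<Xi>: "G y \<in> \<Xi>" using S V(2) y by blast
  have wd: "w \<bullet> d \<le> 0" if "\<And>t. 0 < t \<Longrightarrow> t < 1 \<Longrightarrow> G y + t *\<^sub>R G' y d \<in> \<Xi>" for d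
  proof (rule proximal_normal_curve[where S=S and \<Xi>=\<Xi> and \<kappa>=\<kappa>, OF V der cont])
    show "G ` V \<subseteq> range (G' y)" using E by simp
  qed (use S w that in auto)
  have ker: "w \<bullet> d = 0" if "G' y d = 0" for d
    using wd[of d] wd[of "- d"] that G\<Xi> by (simp add: blinfun.bilinear_simps)
  obtain L where L: "linear L" "\<And>e. e \<in> E \<Longrightarrow> G' y (L e) = e"
    using linear_exists_right_inverse_on[of "blinfun_apply (G' y)" UNIV] E(3)
    by (auto simp: blinfun.bounded_linear_right bounded_linear.linear)
  obtain \<mu> z where \<mu>: "\<mu> \<in> span E" "\<And>e. e \<in> span E \<Longrightarrow> orthogonal z e" "adjoint L w = \<mu> + z"
    using orthogonal_subspace_decomp_exists[of E "adjoint L w"] by metis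
  have w\<mu>: "w \<bullet> v = \<mu> \<bullet> G' y v" for v
  proof -
    have vE: "G' y v \<in> E" using E(3) by auto
    have "w \<bullet> (v - L (G' y v)) = 0"
      by (rule ker) (simp add: blinfun.bilinear_simps L(2)[OF vE])
    then have "w \<bullet> v = adjoint L w \<bullet> G' y v"
      by (simp add: adjoint_clauses[OF L(1)] inner_diff_right)
    also have "\<dots> = \<mu> \<bullet> G' y v"
      using \<mu>(2)[of "G' y v"] vE by (simp add: \<mu>(3) inner_add_left span_base orthogonal_def)
    finally show ?thesis .
  qed
  have "\<mu> \<bullet> (\<xi> - G y) \<le> 0" if \<xi>: "\<xi> \<in> \<Xi>" for \<xi>
  proof -
    have "\<xi> - G y \<in> E" using \<xi> G\<Xi> \<Xi> E(1) by (simp add: subset_iff subspace_diff)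
    then obtain d where d: "\<xi> - G y = G' y d" using E(3) by blast
    have "w \<bullet> d \<le> 0"
    proof (rule wd)
      fix t :: real assume t: "0 < t" "t < 1"
      have "G y + t *\<^sub>R G' y d = (1 - t) *\<^sub>R G y + t *\<^sub>R \<xi>"
        unfolding d[symmetric] by (simp add: algebra_simps)
      then show "G y + t *\<^sub>R G' y d \<in> \<Xi>"
        using convexD[OF \<Xi>(1) G\<Xi> \<xi>, of "1 - t" t] t by simp
    qed
    then show ?thesis using w\<mu> d by simp
  qed
  then show ?thesis
    using \<mu>(1) w\<mu> E(1) by (metis span_eq_iff)
qed

text \<open>The derivatives \<open>G' x\<close> have range \<open>E\<close> for all \<open>x \<in> S\<close>, and their transposes are injective on \<open>E\<close>
  uniformly in \<open>x\<close>: the number \<open>b\<close> stands for a bound on the transpose of \<open>G' x\<close> applied to \<open>\<mu>\<close>.\<close>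
definition uniformly_onto ::
    "('a::real_normed_vector \<Rightarrow> 'b::real_normed_vector \<Rightarrow>\<^sub>L 'c::real_inner) \<Rightarrow> 'a set \<Rightarrow> 'c set \<Rightarrow> real \<Rightarrow> bool" where
  "uniformly_onto G' S E C \<longleftrightarrow>
     (\<forall>x\<in>S. range (G' x) = E \<and>
        (\<forall>\<mu>\<in>E. \<forall>b. (\<forall>v. \<mu> \<bullet> G' x v \<le> b * norm v) \<longrightarrow> norm \<mu> \<le> C * b))"

lemma uniformly_onto_mono:
  assumes "uniformly_onto G' S E C" "T \<subseteq> S" "0 < C" "C \<le> C'"
  shows "uniformly_onto G' T E C'"
  unfolding uniformly_onto_def
proof (intro ballI conjI allI impI)
  fix x assume x: "x \<in> T"
  then show "range (G' x) = E" using assms unfolding uniformly_onto_def by blast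
  fix \<mu> b assume "\<mu> \<in> E" "\<forall>v. \<mu> \<bullet> G' x v \<le> b * norm v"
  then have *: "norm \<mu> \<le> C * b" using assms x unfolding uniformly_onto_def by blast
  then have "0 \<le> C * b" using norm_ge_zero order_trans by blast
  then have "0 \<le> b" using assms(3) by (simp add: zero_le_mult_iff)
  then show "norm \<mu> \<le> C' * b" using * mult_right_mono[OF assms(4)] by (meson order_trans)
qed

lemma range_derivative_subset:
  fixes G :: "'a::real_normed_vector \<Rightarrow> 'b::euclidean_space"
  assumes V: "open V" "x \<in> V" and der: "(G has_derivative G') (at x)"
    and E: "subspace E" "G ` V \<subseteq> E"
  shows "range G' \<subseteq> E"
proof clarify
  fix v
  have lim: "((\<lambda>t. (G (x + t *\<^sub>R v) - G x) /\<^sub>R t) \<longlongrightarrow> G' v) (at_right 0)"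
    by (rule directional_quotient_tendsto[OF der])
  have "((\<lambda>t::real. x + t *\<^sub>R v) \<longlongrightarrow> x + 0 *\<^sub>R v) (at_right 0)"
    by (intro tendsto_intros)
  then have "\<forall>\<^sub>F t in at_right (0::real). x + t *\<^sub>R v \<in> V"
    using topological_tendstoD[OF _ V(1)] V(2) by fastforce
  then have "\<forall>\<^sub>F t in at_right (0::real). (G (x + t *\<^sub>R v) - G x) /\<^sub>R t \<in> E"
  proof eventually_elim
    case (elim t)
    then have "G (x + t *\<^sub>R v) \<in> E" "G x \<in> E" using E(2) V(2) by auto
    then show ?case using E(1) by (simp add: subspace_diff subspace_scale)
  qed
  then show "G' v \<in> E"
    using Lim_in_closed_set[OF closed_subspace[OF E(1)] _ trivial_limit_at_right_real lim] by blast
qed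

lemma uniformly_onto_nearby:
  fixes G' :: "'a::real_normed_vector \<Rightarrow> 'b::euclidean_space \<Rightarrow>\<^sub>L 'c::euclidean_space"
  assumes V: "open V" "y \<in> V" and cont: "continuous_on V G'"
    and E: "subspace E" "range (G' y) = E" and sub: "\<And>x. x \<in> V \<Longrightarrow> range (G' x) \<subseteq> E"
  shows "\<exists>r>0. \<exists>C>0. ball y r \<subseteq> V \<and> uniformly_onto G' (ball y r) E C"
proof -
  obtain L where L: "linear L" "\<And>e. e \<in> E \<Longrightarrow> G' y (L e) = e"
    using linear_exists_right_inverse_on[of "blinfun_apply (G' y)" UNIV] E(2)
    by (auto simp: blinfun.bounded_linear_right bounded_linear.linear)
  obtain K where K: "K > 0" "\<And>e. norm (L e) \<le> norm e * K"
    using bounded_linear.pos_bounded L(1) linear_conv_bounded_linear by metis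
  obtain r0 where r0: "r0 > 0" "ball y r0 \<subseteq> V"
    using V open_contains_ball by blast
  obtain r1 where r1: "r1 > 0" "\<And>x. x \<in> V \<Longrightarrow> dist x y < r1 \<Longrightarrow> dist (G' x) (G' y) < 1 / (2 * K)"
    using cont V(2) K(1) unfolding continuous_on_iff by (metis divide_pos_pos mult_pos_pos zero_less_numeral zero_less_one)
  define r where "r = min r0 r1"
  have r: "r > 0" "ball y r \<subseteq> V" using r0 r1 unfolding r_def by auto
  have bound: "norm \<mu> \<le> (2 * K) * b"
    if x: "x \<in> ball y r" and \<mu>: "\<mu> \<in> E" and b: "\<And>v. \<mu> \<bullet> G' x v \<le> b * norm v" for x \<mu> b
  proof (cases "\<mu> = 0")
    case True
    show ?thesis
    proof (cases "b \<ge> 0")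
      case False
      have "norm (SOME i::'b. i \<in> Basis) = 1" by (simp add: some_in_eq)
      then show ?thesis using b[of "SOME i. i \<in> Basis"] True False by simp
    qed (use True K in simp)
  next
    case False
    have "norm (G' x - G' y) \<le> 1 / (2 * K)"
    proof -
      have "x \<in> V" "dist x y < r1" using x r(2) by (auto simp: r_def dist_commute)
      then show ?thesis using r1(2)[of x] by (simp add: dist_norm)
    qed
    then have "norm ((G' x - G' y) (L \<mu>)) \<le> (1 / (2 * K)) * (norm \<mu> * K)"
      using norm_blinfun[of "G' x - G' y" "L \<mu>"] K(2)[of \<mu>] K(1)
      by (meson mult_mono norm_ge_zero order_trans divide_nonneg_pos mult_pos_pos zero_le_one zero_less_numeral)
    then have "norm ((G' x - G' y) (L \<mu>)) \<le> norm \<mu> / 2" using K(1) by (simp add: field_simps)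
    then have "- (\<mu> \<bullet> (G' x - G' y) (L \<mu>)) \<le> norm \<mu> * (norm \<mu> / 2)"
      using Cauchy_Schwarz_ineq2[of \<mu> "(G' x - G' y) (L \<mu>)"]
        mult_left_mono[of "norm ((G' x - G' y) (L \<mu>))" "norm \<mu> / 2" "norm \<mu>"]
      by simp
    moreover have "\<mu> \<bullet> G' y (L \<mu>) = norm \<mu> * norm \<mu>"
      using L(2)[OF \<mu>] by (simp add: dot_square_norm power2_eq_square)
    ultimately have "norm \<mu> * norm \<mu> / 2 \<le> \<mu> \<bullet> G' x (L \<mu>)"
      by (simp add: blinfun.bilinear_simps inner_diff_right)
    also have "\<dots> \<le> b * norm (L \<mu>)" by (rule b)
    finally have *: "norm \<mu> * norm \<mu> / 2 \<le> b * norm (L \<mu>)" .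
    then have "b * norm (L \<mu>) > 0" 
    proof -
      have "0 < norm \<mu> * norm \<mu> / 2" using False by simp
      then show ?thesis using * by linarith
    qed
    then have "b > 0" by (metis norm_ge_zero zero_less_mult_pos2 zero_less_mult_iff not_less)
    then have "b * norm (L \<mu>) \<le> b * (norm \<mu> * K)" using K(2) by simp
    with * have "norm \<mu> * norm \<mu> \<le> norm \<mu> * (2 * K * b)" by (simp add: field_simps)
    then show ?thesis using False by simp
  qed
  have "range (G' x) = E" if x: "x \<in> ball y r" for x
  proof (rule ccontr)
    assume "range (G' x) \<noteq> E"
    moreover have rs: "subspace (range (G' x))"
      by (simp add: blinfun.bounded_linear_right bounded_linear.linear linear_subspace_image)
    ultimately have "span (range (G' x)) \<subset> span E"
      using sub[of x] x r(2) E(1) by (metis psubsetI span_eq_iff subsetD)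
    then obtain \<mu> where \<mu>: "\<mu> \<noteq> 0" "\<mu> \<in> span E" "\<And>e. e \<in> span (range (G' x)) \<Longrightarrow> orthogonal \<mu> e"
      using orthogonal_to_subspace_exists_gen by metis
    have "norm \<mu> \<le> 2 * K * 0"
    proof (rule bound[OF x])
      show "\<mu> \<in> E" using \<mu>(2) E(1) by (metis span_eq_iff)
      show "\<mu> \<bullet> G' x v \<le> 0 * norm v" for v
        using \<mu>(3)[of "G' x v"] by (simp add: span_base orthogonal_def)
    qed
    then show False using \<mu>(1) by simp
  qed
  then have "uniformly_onto G' (ball y r) E (2 * K)"
    unfolding uniformly_onto_def using bound by blast
  then show ?thesis using r K(1) by (metis mult_pos_pos zero_less_numeral)
qed

section \<open>Cones and projections onto closed convex sets\<close>

lemma image_tangent_cone: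
  assumes V: "open V" "z \<in> V" and der: "(\<eta> has_derivative \<eta>') (at z)"
    and iff: "\<And>x. x \<in> V \<Longrightarrow> x \<in> \<Theta> \<Longrightarrow> \<eta> x \<in> \<Xi>"
    and d: "d \<in> tangent_cone \<Theta> z"
  shows "\<eta>' d \<in> tangent_cone \<Xi> (\<eta> z)"
proof -
  obtain t zs where t: "\<And>k::nat. 0 < t k" "t \<longlonglongrightarrow> 0" and zs: "zs \<longlonglongrightarrow> d"
    and mem: "\<And>k. z + t k *\<^sub>R zs k \<in> \<Theta>"
    using d unfolding tangent_cone_def by blast
  have tpos: "\<forall>\<^sub>F k in sequentially. 0 < t k" using t(1) by simp
  have "(\<lambda>k. z + t k *\<^sub>R zs k) \<longlonglongrightarrow> z + 0 *\<^sub>R d" by (intro tendsto_intros t zs)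
  then have "\<forall>\<^sub>F k in sequentially. z + t k *\<^sub>R zs k \<in> V"
    using topological_tendstoD[OF _ V(1)] V(2) by fastforce
  then obtain N where N: "\<And>k. k \<ge> N \<Longrightarrow> z + t k *\<^sub>R zs k \<in> V"
    unfolding eventually_sequentially by blast
  have "(z + t k *\<^sub>R zs k - z) /\<^sub>R t k = zs k" for k using t(1)[of k] by simp
  then have "(\<lambda>k. (z + t k *\<^sub>R zs k - z) /\<^sub>R t k) \<longlonglongrightarrow> d" using zs by presburger
  then have lim: "(\<lambda>k. (\<eta> (z + t k *\<^sub>R zs k) - \<eta> z) /\<^sub>R t k) \<longlonglongrightarrow> \<eta>' d"
    by (rule difference_quotient_tendsto[OF der t(2) tpos])
  define s where "s k = t (k + N)" for k
  define xs where "xs k = (\<eta> (z + t (k + N) *\<^sub>R zs (k + N)) - \<eta> z) /\<^sub>R t (k + N)" for k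
  have "s \<longlonglongrightarrow> 0" unfolding s_def[abs_def] using t(2) by (rule LIMSEQ_ignore_initial_segment)
  moreover have "xs \<longlonglongrightarrow> \<eta>' d" unfolding xs_def[abs_def] by (rule LIMSEQ_ignore_initial_segment[OF lim])
  moreover have "0 < s k" for k unfolding s_def by (rule t(1))
  moreover have "\<eta> z + s k *\<^sub>R xs k \<in> \<Xi>" for k
  proof -
    have "\<eta> z + s k *\<^sub>R xs k = \<eta> (z + t (k + N) *\<^sub>R zs (k + N))"
      unfolding s_def xs_def using t(1)[of "k + N"] by simp
    then show ?thesis using iff[OF N mem] by simp
  qed
  ultimately show ?thesis unfolding tangent_cone_def by blast
qed

text \<open>The kernel lies in the tangent cone by \<open>curve_in_direction\<close>. Conversely, a line in the tangent
  cone is mapped to a line in the pointed cone \<open>tangent_cone \<Xi> (\<eta> z)\<close>. So the kernel is the greatest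
  subspace, and the greatest element in the definition of \<open>lin\<close> exists.\<close>
lemma lin_tangent_cone:
  fixes \<eta> :: "'a::euclidean_space \<Rightarrow> 'b::euclidean_space"
  assumes V: "open V" "z \<in> V" and z: "z \<in> \<Theta>"
    and der: "\<And>x. x \<in> V \<Longrightarrow> (\<eta> has_derivative blinfun_apply (\<eta>' x)) (at x)"
    and cont: "continuous_on V \<eta>'" and E: "\<eta> ` V \<subseteq> range (\<eta>' z)"
    and iff: "\<And>x. x \<in> V \<Longrightarrow> x \<in> \<Theta> \<longleftrightarrow> \<eta> x \<in> \<Xi>"
    and pt: "pointed (tangent_cone \<Xi> (\<eta> z))"
  shows "lin (tangent_cone \<Theta> z) = {d. \<eta>' z d = 0}"
  unfolding lin_def
proof (rule Greatest_equality, intro conjI)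
  show "subspace {d. \<eta>' z d = 0}"
    by (auto simp: subspace_def blinfun.bilinear_simps)
  show "{d. \<eta>' z d = 0} \<subseteq> tangent_cone \<Theta> z"
  proof clarify
    fix d assume d: "\<eta>' z d = 0"
    obtain \<delta> c where \<delta>: "\<delta> > 0" and c0: "c 0 = z" and dc: "(c has_vector_derivative d) (at 0)"
      and c: "\<And>t. \<bar>t\<bar> < \<delta> \<Longrightarrow> c t \<in> V \<and> \<eta> (c t) = \<eta> z + t *\<^sub>R \<eta>' z d"
      using curve_in_direction[OF V der cont E] by metis
    have q: "((\<lambda>t. (c t - z) /\<^sub>R t) \<longlongrightarrow> d) (at_right 0)"
      using directional_quotient_tendsto[OF dc[unfolded has_vector_derivative_def], of 1] c0 by simp
    define t where "t k = \<delta> / real (k + 2)" for k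
    have t: "0 < t k" "t k < \<delta>" for k
      unfolding t_def using \<delta> by (auto simp: divide_less_eq)
    have t0: "t \<longlonglongrightarrow> 0"
      unfolding t_def[abs_def] by (rule LIMSEQ_ignore_initial_segment[OF lim_const_over_n])
    have "filterlim t (at_right 0) sequentially"
      using t t0 unfolding filterlim_at by (auto intro!: always_eventually simp: less_imp_neq[symmetric])
    then have "(\<lambda>k. (c (t k) - z) /\<^sub>R t k) \<longlonglongrightarrow> d"
      by (rule filterlim_compose[OF q])
    moreover have "z + t k *\<^sub>R ((c (t k) - z) /\<^sub>R t k) \<in> \<Theta>" for k
    proof -
      have "c (t k) \<in> V" "\<eta> (c (t k)) = \<eta> z" using c[of "t k"] t[of k] d by auto
      then have "c (t k) \<in> \<Theta>" using iff V(2) z by simp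
      then show ?thesis using t(1)[of k] by simp
    qed
    ultimately show "d \<in> tangent_cone \<Theta> z"
      unfolding tangent_cone_def using t(1) t0 by blast
  qed
  fix L assume L: "subspace L \<and> L \<subseteq> tangent_cone \<Theta> z"
  show "L \<subseteq> {d. \<eta>' z d = 0}"
  proof clarify
    fix d assume d: "d \<in> L"
    then have "- d \<in> L" using L by (simp add: subspace_neg)
    then have "\<eta>' z d \<in> tangent_cone \<Xi> (\<eta> z)" "\<eta>' z (- d) \<in> tangent_cone \<Xi> (\<eta> z)"
      using image_tangent_cone[OF V der[OF V(2)], of \<Theta> \<Xi>] iff L d by blast+
    moreover have "\<eta>' z d = - \<eta>' z (- d)" by (simp add: blinfun.bilinear_simps)
    ultimately have "\<eta>' z d \<in> tangent_cone \<Xi> (\<eta> z) \<inter> uminus ` tangent_cone \<Xi> (\<eta> z)"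
      by blast
    then show "\<eta>' z d = 0" using pt unfolding pointed_def by blast
  qed
qed

text \<open>For \<open>z\<close> in the cone \<open>K\<close>, \<open>z\<close> is normal to the polar cone at \<open>\<nu>\<close> if and only if \<open>\<nu>\<close> is
  normal to \<open>K\<close> at \<open>z\<close>. Both amount to \<open>\<nu> \<in> polar_cone K\<close> and \<open>\<nu> \<bullet> z = 0\<close>.\<close>
lemma polar_normal_cone_iff:
  assumes "cone K" "z \<in> K"
  shows "z \<in> normal_cone (polar_cone K) \<nu> \<longleftrightarrow> (\<forall>x\<in>K. \<nu> \<bullet> (x - z) \<le> 0)"
proof
  assume "z \<in> normal_cone (polar_cone K) \<nu>"
  then have \<nu>: "\<nu> \<in> polar_cone K" and *: "\<And>w. w \<in> polar_cone K \<Longrightarrow> z \<bullet> (w - \<nu>) \<le> 0"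
    unfolding normal_cone_def by (auto split: if_splits)
  have "0 \<in> polar_cone K" unfolding polar_cone_def by simp
  from *[OF this] have "0 \<le> \<nu> \<bullet> z" by (simp add: inner_commute)
  then show "\<forall>x\<in>K. \<nu> \<bullet> (x - z) \<le> 0"
    using \<nu> unfolding polar_cone_def by (force simp: inner_diff_right)
next
  assume n: "\<forall>x\<in>K. \<nu> \<bullet> (x - z) \<le> 0"
  have "0 *\<^sub>R z \<in> K" "2 *\<^sub>R z \<in> K"
    using mem_cone[OF assms, of 0] mem_cone[OF assms, of 2] by simp_all
  then have "\<nu> \<bullet> (0 *\<^sub>R z - z) \<le> 0" "\<nu> \<bullet> (2 *\<^sub>R z - z) \<le> 0" using n by blast+
  then have z: "\<nu> \<bullet> z = 0" by (simp add: inner_diff_right)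
  then have "\<nu> \<in> polar_cone K" using n unfolding polar_cone_def by (simp add: inner_diff_right)
  moreover have "z \<bullet> (w - \<nu>) \<le> 0" if "w \<in> polar_cone K" for w
  proof -
    have "w \<bullet> z \<le> 0" using that assms(2) unfolding polar_cone_def by blast
    then show ?thesis using z by (simp add: inner_diff_right inner_commute[of z])
  qed
  ultimately show "z \<in> normal_cone (polar_cone K) \<nu>" unfolding normal_cone_def by simp
qed

lemma closest_point_add_normal:
  fixes S :: "'a::euclidean_space set"
  assumes "closed S" "convex S" "x \<in> S" "\<And>z. z \<in> S \<Longrightarrow> \<nu> \<bullet> (z - x) \<le> 0"
  shows "closest_point S (x + \<nu>) = x"
proof -
  have "dist (x + \<nu>) x \<le> dist (x + \<nu>) z" if "z \<in> S" for z
  proof -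
    define e where "e = z - x"
    have "(norm (\<nu> - e))\<^sup>2 = (norm \<nu>)\<^sup>2 - 2 * (\<nu> \<bullet> e) + (norm e)\<^sup>2"
      by (simp add: power2_norm_eq_inner inner_diff_left inner_diff_right inner_commute)
    then have "(norm \<nu>)\<^sup>2 \<le> (norm (\<nu> - (z - x)))\<^sup>2"
      using assms(4)[OF that] zero_le_power2[of "norm e"] unfolding e_def by linarith
    then have "norm \<nu> \<le> norm (\<nu> - (z - x))" by (rule power2_le_imp_le) simp
    then show ?thesis by (simp add: dist_norm algebra_simps)
  qed
  then show ?thesis using closest_point_unique[of S x "x + \<nu>"] assms(1-3) by simp
qed

text \<open>The projection is firmly nonexpansive, and this passes to its directional derivative at a fixed
  point.\<close>
lemma dir_deriv_closest_point_monotone: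
  fixes S :: "'a::euclidean_space set"
  assumes S: "closed S" "convex S" "S \<noteq> {}"
    and p: "has_dir_deriv (closest_point S) z w p"
    and p': "has_dir_deriv (closest_point S) z w' p'"
  shows "0 \<le> (p - p') \<bullet> ((w - p) - (w' - p'))"
proof -
  let ?P = "closest_point S"
  let ?q = "\<lambda>w t. (?P (z + t *\<^sub>R w) - ?P z) /\<^sub>R t"
  have q: "(?q w \<longlongrightarrow> p) (at_right 0)" "(?q w' \<longlongrightarrow> p') (at_right 0)"
    using p p' unfolding has_dir_deriv_def by auto
  have "((\<lambda>t. (?q w t - ?q w' t) \<bullet> ((w - ?q w t) - (w' - ?q w' t)))
      \<longlongrightarrow> (p - p') \<bullet> ((w - p) - (w' - p'))) (at_right 0)"
    by (intro tendsto_intros q)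
  moreover have "\<forall>\<^sub>F t in at_right (0::real). 0 \<le> (?q w t - ?q w' t) \<bullet> ((w - ?q w t) - (w' - ?q w' t))"
    using eventually_at_right_less[of "0::real"]
  proof eventually_elim
    case (elim t)
    define a where "a = ?P (z + t *\<^sub>R w)"
    define a' where "a' = ?P (z + t *\<^sub>R w')"
    have "a \<in> S" "a' \<in> S" unfolding a_def a'_def using S closest_point_in_set by blast+
    then have dot: "(z + t *\<^sub>R w - a) \<bullet> (a' - a) \<le> 0" "(z + t *\<^sub>R w' - a') \<bullet> (a - a') \<le> 0"
      unfolding a_def a'_def using S closest_point_dot by blast+
    have eq: "(a - a') \<bullet> ((b - a) - (b' - a')) = - ((b - a) \<bullet> (a' - a)) - (b' - a') \<bullet> (a - a')" for b b'
      by (simp add: inner_diff_left inner_diff_right inner_commute)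
    have "0 \<le> (a - a') \<bullet> ((z + t *\<^sub>R w - a) - (z + t *\<^sub>R w' - a'))"
      unfolding eq using dot by linarith
    moreover have "t *\<^sub>R (?q w t - ?q w' t) = a - a'"
      using elim unfolding a_def a'_def by (simp add: scaleR_diff_right)
    moreover have "t *\<^sub>R ((w - ?q w t) - (w' - ?q w' t)) = (z + t *\<^sub>R w - a) - (z + t *\<^sub>R w' - a')"
      using elim unfolding a_def a'_def by (simp add: scaleR_diff_right)
    ultimately have "0 \<le> (t *\<^sub>R (?q w t - ?q w' t)) \<bullet> (t *\<^sub>R ((w - ?q w t) - (w' - ?q w' t)))"
      by (simp only:)
    then have "0 \<le> (t * t) * ((?q w t - ?q w' t) \<bullet> ((w - ?q w t) - (w' - ?q w' t)))"
      by (simp only: inner_scaleR_left inner_scaleR_right mult.assoc)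
    then have "(t * t) * 0 \<le> (t * t) * ((?q w t - ?q w' t) \<bullet> ((w - ?q w t) - (w' - ?q w' t)))"
      by (simp only: mult_zero_right)
    then show ?case by (rule mult_left_le_imp_le) (use elim in simp)
  qed
  ultimately show ?thesis
    by (rule tendsto_lowerbound) simp
qed

section \<open>Multipliers of a regular constraint system\<close>

text \<open>A constraint \<open>g y \<in> \<Theta>\<close> for \<open>y \<in> Y\<close>, with values of \<open>g\<close> in \<open>W\<close>, where \<open>\<Theta>\<close> is described by
  \<open>\<eta> z \<in> \<Xi>\<close>. The two assumptions \<open>uniformly_onto\<close> are the reducibility of \<open>\<Theta>\<close> and the nondegeneracy
  of \<open>g\<close>, uniformly on \<open>W\<close> and \<open>Y\<close>. The constant \<open>K\<close> bounds derivatives and \<open>C\<close> bounds inverses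
  of transposes.\<close>
locale regular_constraint =
  fixes g :: "'a::euclidean_space \<Rightarrow> 'b::euclidean_space"
    and g' :: "'a \<Rightarrow> 'a \<Rightarrow>\<^sub>L 'b" and g'' :: "'a \<Rightarrow> 'a \<Rightarrow>\<^sub>L 'a \<Rightarrow>\<^sub>L 'b"
    and \<eta> :: "'b \<Rightarrow> 'c::euclidean_space"
    and \<eta>' :: "'b \<Rightarrow> 'b \<Rightarrow>\<^sub>L 'c" and \<eta>'' :: "'b \<Rightarrow> 'b \<Rightarrow>\<^sub>L 'b \<Rightarrow>\<^sub>L 'c"
    and \<Theta> :: "'b set" and \<Xi> E :: "'c set" and Y :: "'a set" and W :: "'b set" and K C :: real
  assumes closed_\<Theta>: "closed \<Theta>" and convex_\<Theta>: "convex \<Theta>"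
    and convex_\<Xi>: "convex \<Xi>" and \<Xi>_E: "\<Xi> \<subseteq> E" and subspace_E: "subspace E"
    and open_Y: "open Y" and open_W: "open W" and g_Y: "g ` Y \<subseteq> W"
    and g: "second_order_bounds g g' g'' Y K"
    and \<eta>: "second_order_bounds \<eta> \<eta>' \<eta>'' W K"
    and \<eta>_E: "\<eta> ` W \<subseteq> E" and \<eta>_iff: "\<And>z. z \<in> W \<Longrightarrow> z \<in> \<Theta> \<longleftrightarrow> \<eta> z \<in> \<Xi>"
    and \<eta>_onto: "uniformly_onto \<eta>' W E C"
    and \<eta>g_onto: "uniformly_onto (\<lambda>y. \<eta>' (g y) o\<^sub>L g' y) Y E C"
    and K_pos: "0 < K" and C_pos: "0 < C"

begin

text \<open>The vector \<open>\<nu>\<close> is normal to \<open>\<Theta>\<close> at \<open>g y\<close>, and \<open>u - y\<close> is its image under the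
  transpose of \<open>g' y\<close>.\<close>
definition multiplier :: "'a \<Rightarrow> 'a \<Rightarrow> 'b \<Rightarrow> bool" where
  "multiplier u y \<nu> \<longleftrightarrow> y \<in> Y \<and> g y \<in> \<Theta> \<and> (\<forall>v. (u - y) \<bullet> v = \<nu> \<bullet> g' y v) \<and>
     (\<forall>z\<in>\<Theta>. \<nu> \<bullet> (z - g y) \<le> 0)"

text \<open>The linearized system, with its first equation tested by all \<open>d\<close>. The term \<open>\<nu> \<bullet> g'' y v1 d\<close> is
  the Hessian of \<open>\<nu> \<bullet> g\<close> at \<open>y\<close> applied to \<open>v1\<close> and \<open>d\<close>.\<close>
definition solves :: "'a \<Rightarrow> 'b \<Rightarrow> 'a \<Rightarrow> 'a \<times> 'b \<Rightarrow> bool" where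
  "solves y \<nu> h = (\<lambda>(v1, v2).
     (\<forall>d. h \<bullet> d = v1 \<bullet> d + \<nu> \<bullet> g'' y v1 d + v2 \<bullet> g' y d) \<and>
     has_dir_deriv (closest_point \<Theta>) (g y + \<nu>) (g' y v1 + v2) (g' y v1))"

lemma gD:
  assumes "y \<in> Y"
  shows "(g has_derivative g' y) (at y)" "(g' has_derivative g'' y) (at y)"
    "norm (g' y) \<le> K" "norm (g'' y) \<le> K" "g y \<in> W"
  using g g_Y assms unfolding second_order_bounds_def by auto

lemma gD2:
  assumes "y \<in> Y" "y' \<in> Y"
  shows "norm (g y - g y') \<le> K * norm (y - y')" "norm (g' y - g' y') \<le> K * norm (y - y')"
    "norm (g y - g y' - g' y' (y - y')) \<le> K * (norm (y - y'))\<^sup>2"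
  using g assms unfolding second_order_bounds_def by auto

lemma \<eta>D:
  assumes "z \<in> W"
  shows "(\<eta> has_derivative \<eta>' z) (at z)" "norm (\<eta>' z) \<le> K" "range (\<eta>' z) = E"
  using \<eta> \<eta>_onto assms unfolding second_order_bounds_def uniformly_onto_def by auto

lemma \<eta>'_lipschitz:
  assumes "z \<in> W" "z' \<in> W" shows "norm (\<eta>' z - \<eta>' z') \<le> K * norm (z - z')"
  using \<eta> assms unfolding second_order_bounds_def by auto

lemma continuous_on_\<eta>': "continuous_on W \<eta>'"
  using \<eta> unfolding second_order_bounds_def
  by (meson has_derivative_continuous continuous_at_imp_continuous_on)

lemma \<eta>_lower_bound:
  assumes "z \<in> W" "\<mu> \<in> E" "\<And>v. \<mu> \<bullet> \<eta>' z v \<le> b * norm v" shows "norm \<mu> \<le> C * b"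
  using \<eta>_onto assms unfolding uniformly_onto_def by blast

lemma \<eta>g_lower_bound:
  assumes "y \<in> Y" "\<mu> \<in> E" "\<And>v. \<mu> \<bullet> \<eta>' (g y) (g' y v) \<le> b * norm v" shows "norm \<mu> \<le> C * b"
  using \<eta>g_onto assms unfolding uniformly_onto_def by fastforce

lemma \<eta>'_norm_apply_diff:
  assumes "z \<in> W" "z' \<in> W" shows "norm (\<eta>' z v - \<eta>' z' v) \<le> K * norm (z - z') * norm v"
  using norm_blinfun_le_mult[OF \<eta>'_lipschitz[OF assms]] by (simp add: blinfun.diff_left)

lemma normal_representation:
  assumes z: "z \<in> W" "z \<in> \<Theta>" and \<nu>: "\<And>x. x \<in> \<Theta> \<Longrightarrow> \<nu> \<bullet> (x - z) \<le> 0"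
  shows "\<exists>\<mu>\<in>E. (\<forall>v. \<nu> \<bullet> v = \<mu> \<bullet> \<eta>' z v) \<and> norm \<mu> \<le> C * norm \<nu>"
proof -
  have "\<exists>\<mu>\<in>E. (\<forall>v. \<nu> \<bullet> v = \<mu> \<bullet> \<eta>' z v) \<and> (\<forall>\<xi>\<in>\<Xi>. \<mu> \<bullet> (\<xi> - \<eta> z) \<le> 0)"
    by (rule proximal_normal_multiplier[where V=W and S=\<Theta> and \<kappa>=0])
       (use z \<nu> open_W \<eta>D continuous_on_\<eta>' subspace_E \<eta>_E \<eta>_iff convex_\<Xi> \<Xi>_E in auto)
  then obtain \<mu> where \<mu>: "\<mu> \<in> E" "\<And>v. \<nu> \<bullet> v = \<mu> \<bullet> \<eta>' z v" by blast
  have "norm \<mu> \<le> C * norm \<nu>"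
    by (rule \<eta>_lower_bound[OF z(1) \<mu>(1)]) (simp add: \<mu>(2)[symmetric] norm_cauchy_schwarz)
  then show ?thesis using \<mu> by blast
qed

lemma multiplier_exists:
  assumes y: "y \<in> Y" "g y \<in> \<Theta>"
    and w: "\<And>x. g x \<in> \<Theta> \<Longrightarrow> (u - y) \<bullet> (x - y) \<le> \<kappa> * (norm (x - y))\<^sup>2"
  shows "\<exists>\<nu>. multiplier u y \<nu>"
proof -
  have cont: "continuous_on Y (\<lambda>y. \<eta>' (g y) o\<^sub>L g' y)"
  proof (intro continuous_intros)
    show "continuous_on Y (\<lambda>y. \<eta>' (g y))"
    proof (rule continuous_on_compose2[OF continuous_on_\<eta>' _ g_Y])
      show "continuous_on Y g"
        using gD(1) by (meson has_derivative_continuous continuous_at_imp_continuous_on)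
    qed
    show "continuous_on Y g'"
      using gD(2) by (meson has_derivative_continuous continuous_at_imp_continuous_on)
  qed
  have der: "((\<lambda>y. \<eta> (g y)) has_derivative blinfun_apply (\<eta>' (g x) o\<^sub>L g' x)) (at x)" if "x \<in> Y" for x
    using diff_chain_at[OF gD(1)[OF that] \<eta>D(1)[OF gD(5)[OF that]]]
    by (simp add: o_def blinfun_compose.rep_eq)
  have "\<exists>\<mu>\<in>E. (\<forall>v. (u - y) \<bullet> v = \<mu> \<bullet> (\<eta>' (g y) o\<^sub>L g' y) v) \<and> (\<forall>\<xi>\<in>\<Xi>. \<mu> \<bullet> (\<xi> - \<eta> (g y)) \<le> 0)"
  proof (rule proximal_normal_multiplier[where V=Y and S="g -` \<Theta>" and \<kappa>=\<kappa> and G="\<lambda>y. \<eta> (g y)"])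
    show "range (blinfun_apply (\<eta>' (g y) o\<^sub>L g' y)) = E"
      using \<eta>g_onto y(1) unfolding uniformly_onto_def by blast
    show "(\<lambda>y. \<eta> (g y)) ` Y \<subseteq> E" using \<eta>_E g_Y by blast
    show "x \<in> g -` \<Theta> \<longleftrightarrow> \<eta> (g x) \<in> \<Xi>" if "x \<in> Y" for x using \<eta>_iff gD(5)[OF that] by simp
  qed (use y w der cont open_Y subspace_E convex_\<Xi> \<Xi>_E in auto)
  then obtain \<mu> where \<mu>: "\<mu> \<in> E" "\<And>v. (u - y) \<bullet> v = \<mu> \<bullet> \<eta>' (g y) (g' y v)"
    "\<And>\<xi>. \<xi> \<in> \<Xi> \<Longrightarrow> \<mu> \<bullet> (\<xi> - \<eta> (g y)) \<le> 0"
    by auto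
  define \<nu> where "\<nu> = adjoint (\<eta>' (g y)) \<mu>"
  have \<nu>: "\<nu> \<bullet> v = \<mu> \<bullet> \<eta>' (g y) v" for v
    unfolding \<nu>_def
    by (simp add: adjoint_clauses blinfun.bounded_linear_right bounded_linear.linear)
  have "\<nu> \<bullet> (z - g y) \<le> 0" if z: "z \<in> \<Theta>" for z
  proof -
    let ?x = "\<lambda>t. g y + t *\<^sub>R (z - g y)"
    have "((\<lambda>t. (\<eta> (?x t) - \<eta> (g y)) /\<^sub>R t) \<longlongrightarrow> \<eta>' (g y) (z - g y)) (at_right 0)"
      by (rule directional_quotient_tendsto[OF \<eta>D(1)[OF gD(5)[OF y(1)]]])
    then have lim: "((\<lambda>t. \<mu> \<bullet> ((\<eta> (?x t) - \<eta> (g y)) /\<^sub>R t)) \<longlongrightarrow> \<mu> \<bullet> \<eta>' (g y) (z - g y)) (at_right 0)"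
      by (intro tendsto_intros)
    have "(?x \<longlongrightarrow> g y + 0 *\<^sub>R (z - g y)) (at_right 0)" by (intro tendsto_intros)
    then have inW: "\<forall>\<^sub>F t in at_right 0. ?x t \<in> W"
      using topological_tendstoD[OF _ open_W] gD(5)[OF y(1)] by fastforce
    have "\<forall>\<^sub>F t in at_right (0::real). t < 1"
      unfolding eventually_at_right_field by (rule exI[of _ 1]) simp
    then have "\<forall>\<^sub>F t in at_right 0. \<mu> \<bullet> ((\<eta> (?x t) - \<eta> (g y)) /\<^sub>R t) \<le> 0"
      using eventually_at_right_less[of "0::real"] inW
    proof eventually_elim
      case (elim t)
      have "?x t = (1 - t) *\<^sub>R g y + t *\<^sub>R z" by (simp add: algebra_simps)
      then have "?x t \<in> \<Theta>"
        using convexD[OF convex_\<Theta> y(2) z, of "1 - t" t] elim by simp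
      then have "\<eta> (?x t) \<in> \<Xi>" using \<eta>_iff[OF elim(3)] by simp
      then show ?case using \<mu>(3) elim(2) by (simp add: mult_nonneg_nonpos)
    qed
    then have "\<mu> \<bullet> \<eta>' (g y) (z - g y) \<le> 0"
      by (rule tendsto_upperbound[OF lim]) simp
    then show ?thesis using \<nu> by simp
  qed
  then show ?thesis
    unfolding multiplier_def using y \<mu>(2) \<nu> by (intro exI[of _ \<nu>]) simp
qed

lemma projection_multiplier:
  assumes y: "y \<in> metric_projection (g -` \<Theta>) u" "y \<in> Y"
  shows "\<exists>\<nu>. multiplier u y \<nu>"
proof (rule multiplier_exists[OF y(2)])
  show "g y \<in> \<Theta>" using y unfolding metric_projection_def by simp
  fix x assume "g x \<in> \<Theta>"
  then have "dist u y \<le> dist u x" using y unfolding metric_projection_def by simp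
  then have "(norm (u - y))\<^sup>2 \<le> (norm (u - x))\<^sup>2" by (simp add: dist_norm)
  also have "(norm (u - x))\<^sup>2 = (norm (u - y))\<^sup>2 - 2 * ((u - y) \<bullet> (x - y)) + (norm (x - y))\<^sup>2"
    by (simp add: power2_norm_eq_inner inner_diff_left inner_diff_right inner_commute)
  finally show "(u - y) \<bullet> (x - y) \<le> (1 / 2) * (norm (x - y))\<^sup>2" by simp
qed

text \<open>Nondegeneracy at \<open>y\<close>: the kernel of \<open>\<eta>' (g y)\<close> and the range of \<open>g' y\<close> span the whole space.\<close>
lemma separation:
  assumes y: "y \<in> Y" and ker: "\<And>d. \<eta>' (g y) d = 0 \<Longrightarrow> \<omega> \<bullet> d = 0" and ran: "\<And>v. \<omega> \<bullet> g' y v = 0"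
  shows "\<omega> = 0"
proof -
  have "\<eta>' (g y) \<omega> \<in> range (blinfun_apply (\<eta>' (g y) o\<^sub>L g' y))"
    using \<eta>g_onto y \<eta>D(3)[OF gD(5)[OF y]] unfolding uniformly_onto_def by auto
  then obtain v where "\<eta>' (g y) \<omega> = \<eta>' (g y) (g' y v)" by auto
  then have "\<omega> \<bullet> (\<omega> - g' y v) = 0" by (intro ker) (simp add: blinfun.bilinear_simps)
  then show ?thesis using ran by (simp add: inner_diff_right)
qed

lemma multiplier_representation:
  assumes "multiplier u y \<nu>"
  shows "\<exists>\<mu>\<in>E. (\<forall>v. \<nu> \<bullet> v = \<mu> \<bullet> \<eta>' (g y) v) \<and> norm \<mu> \<le> C * norm (u - y)"
proof -
  have y: "y \<in> Y" "g y \<in> \<Theta>" and s: "\<And>v. (u - y) \<bullet> v = \<nu> \<bullet> g' y v"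
    and n: "\<And>z. z \<in> \<Theta> \<Longrightarrow> \<nu> \<bullet> (z - g y) \<le> 0"
    using assms unfolding multiplier_def by auto
  obtain \<mu> where \<mu>: "\<mu> \<in> E" "\<And>v. \<nu> \<bullet> v = \<mu> \<bullet> \<eta>' (g y) v"
    using normal_representation[OF gD(5)[OF y(1)] y(2) n] by blast
  have "norm \<mu> \<le> C * norm (u - y)"
    by (rule \<eta>g_lower_bound[OF y(1) \<mu>(1)])
       (simp add: \<mu>(2)[symmetric] s[symmetric] norm_cauchy_schwarz)
  then show ?thesis using \<mu> by blast
qed

lemma multiplier_unique:
  assumes "multiplier u y \<nu>" "multiplier u y \<nu>'" shows "\<nu> = \<nu>'"
proof -
  obtain \<mu> \<mu>' where "\<And>v. \<nu> \<bullet> v = \<mu> \<bullet> \<eta>' (g y) v" "\<And>v. \<nu>' \<bullet> v = \<mu>' \<bullet> \<eta>' (g y) v"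
    using assms multiplier_representation by metis
  then have "\<nu> - \<nu>' = 0"
    using assms by (intro separation[of y]) (auto simp: multiplier_def inner_diff_left)
  then show ?thesis by simp
qed

lemma multiplier_norm_le:
  assumes "multiplier u y \<nu>" shows "norm \<nu> \<le> C * K * norm (u - y)"
proof -
  have y: "g y \<in> W" using assms gD(5) unfolding multiplier_def by blast
  obtain \<mu> where \<mu>: "\<And>v. \<nu> \<bullet> v = \<mu> \<bullet> \<eta>' (g y) v" "norm \<mu> \<le> C * norm (u - y)"
    using multiplier_representation[OF assms] by blast
  show ?thesis
  proof (rule norm_le_of_inner_le)
    fix v
    have "\<bar>\<nu> \<bullet> v\<bar> \<le> (C * norm (u - y)) * (K * norm v)"
      unfolding \<mu>(1) by (intro abs_inner_le_mult \<mu>(2) norm_blinfun_le_mult \<eta>D(2) y)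
    then show "\<nu> \<bullet> v \<le> C * K * norm (u - y) * norm v" by (simp add: mult_ac)
  qed (use C_pos K_pos in auto)
qed

text \<open>A quantitative form of monotonicity: the normal \<open>\<nu>\<close> has nonpositive inner product with
  \<open>g y' - g y\<close>, which differs from \<open>g' y (y' - y)\<close> by a quadratic error.\<close>
lemma multiplier_inner_lower:
  assumes "multiplier u y \<nu>" "multiplier u' y' \<nu>'"
  shows "- (norm \<nu> * (K * (norm (y - y'))\<^sup>2)) \<le> \<nu> \<bullet> g' y (y - y')"
proof -
  have Y: "y \<in> Y" "y' \<in> Y" using assms unfolding multiplier_def by auto
  define e where "e = g y' - g y - g' y (y' - y)"
  have "norm e \<le> K * (norm (y - y'))\<^sup>2"
    unfolding e_def using gD2(3)[OF Y(2,1)] by (simp add: norm_minus_commute)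
  then have "\<bar>\<nu> \<bullet> e\<bar> \<le> norm \<nu> * (K * (norm (y - y'))\<^sup>2)"
    by (intro abs_inner_le_mult order_refl)
  moreover have "\<nu> \<bullet> (g y' - g y) \<le> 0" using assms unfolding multiplier_def by blast
  moreover have "\<nu> \<bullet> g' y (y - y') = \<nu> \<bullet> e - \<nu> \<bullet> (g y' - g y)"
    unfolding e_def by (simp add: blinfun.bilinear_simps inner_diff_right)
  ultimately show ?thesis by linarith
qed

lemma projection_lipschitz:
  assumes m: "multiplier u y \<nu>" "multiplier u' y' \<nu>'"
    and small: "K * norm \<nu> \<le> 1 / 4" "K * norm \<nu>' \<le> 1 / 4"
  shows "norm (y - y') \<le> 2 * norm (u - u')"
proof -
  let ?n = "norm (y - y')"
  have "(u - y) \<bullet> (y - y') \<ge> - (norm \<nu> * (K * ?n\<^sup>2))"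
    using multiplier_inner_lower[OF m] m(1) unfolding multiplier_def by simp
  moreover have "norm \<nu> * (K * ?n\<^sup>2) \<le> 1/4 * ?n\<^sup>2"
    using mult_right_mono[OF small(1), of "?n\<^sup>2"] by (simp add: mult_ac)
  moreover have "(u' - y') \<bullet> (y' - y) \<ge> - (norm \<nu>' * (K * ?n\<^sup>2))"
    using multiplier_inner_lower[OF m(2,1)] m(2) unfolding multiplier_def by (simp add: norm_minus_commute)
  moreover have "norm \<nu>' * (K * ?n\<^sup>2) \<le> 1/4 * ?n\<^sup>2"
    using mult_right_mono[OF small(2), of "?n\<^sup>2"] by (simp add: mult_ac)
  moreover have "(u - u') \<bullet> (y - y') = ?n\<^sup>2 + (u - y) \<bullet> (y - y') + (u' - y') \<bullet> (y' - y)"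
    by (simp add: power2_norm_eq_inner inner_diff_left inner_diff_right inner_commute)
  ultimately have "?n\<^sup>2 / 2 \<le> (u - u') \<bullet> (y - y')" by linarith
  also have "\<dots> \<le> norm (u - u') * ?n" by (rule norm_cauchy_schwarz)
  finally have "?n * ?n \<le> (2 * norm (u - u')) * ?n" by (simp add: power2_eq_square)
  then show ?thesis by (cases "?n = 0") auto
qed

text \<open>Let \<open>\<mu>\<close> and \<open>\<mu>'\<close> represent \<open>\<nu>\<close> and \<open>\<nu>'\<close> in \<open>E\<close>. Subtracting the representations of \<open>u - y\<close> and
  \<open>u' - y'\<close> bounds the transposed derivative of \<open>\<eta> \<circ> g\<close> at \<open>y\<close> applied to \<open>\<mu> - \<mu>'\<close>, hence \<open>\<mu> - \<mu>'\<close>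
  and then \<open>\<nu> - \<nu>'\<close>.\<close>
lemma multiplier_lipschitz:
  "\<exists>L\<ge>0. \<forall>u y \<nu> u' y' \<nu>'. multiplier u y \<nu> \<longrightarrow> multiplier u' y' \<nu>' \<longrightarrow>
     K * norm \<nu> \<le> 1 / 4 \<longrightarrow> K * norm \<nu>' \<le> 1 / 4 \<longrightarrow> norm (u' - y') \<le> 1 \<longrightarrow>
     norm (\<nu> - \<nu>') \<le> L * norm (u - u')"
proof -
  define D where "D = C * (3 + 2 * C * (K ^ 3 + K ^ 2))"
  define L where "L = D * K + 2 * C * K ^ 2"
  have D: "D \<ge> 0" unfolding D_def using C_pos K_pos by simp
  have L: "L \<ge> 0" unfolding L_def using D C_pos K_pos by simp
  have main: "norm (\<nu> - \<nu>') \<le> L * norm (u - u')"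
    if m: "multiplier u y \<nu>" "multiplier u' y' \<nu>'"
      and small: "K * norm \<nu> \<le> 1 / 4" "K * norm \<nu>' \<le> 1 / 4" and u': "norm (u' - y') \<le> 1"
    for u y \<nu> u' y' \<nu>'
  proof -
    let ?\<delta> = "norm (u - u')"
    have Y: "y \<in> Y" "y' \<in> Y" using m unfolding multiplier_def by auto
    have W: "g y \<in> W" "g y' \<in> W" using Y gD(5) by auto
    have s: "\<And>v. (u - y) \<bullet> v = \<nu> \<bullet> g' y v" "\<And>v. (u' - y') \<bullet> v = \<nu>' \<bullet> g' y' v"
      using m unfolding multiplier_def by auto
    have yy: "norm (y - y') \<le> 2 * ?\<delta>" by (rule projection_lipschitz[OF m small])
    have gg: "norm (g y - g y') \<le> K * (2 * ?\<delta>)"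
      using gD2(1)[OF Y] mult_left_mono[OF yy less_imp_le[OF K_pos]] by linarith
    obtain \<mu> where \<mu>: "\<mu> \<in> E" "\<And>v. \<nu> \<bullet> v = \<mu> \<bullet> \<eta>' (g y) v"
      using multiplier_representation[OF m(1)] by blast
    obtain \<mu>' where \<mu>': "\<mu>' \<in> E" "\<And>v. \<nu>' \<bullet> v = \<mu>' \<bullet> \<eta>' (g y') v" "norm \<mu>' \<le> C * norm (u' - y')"
      using multiplier_representation[OF m(2)] by blast
    have \<mu>'C: "norm \<mu>' \<le> C" using \<mu>'(3) mult_left_mono[OF u' less_imp_le[OF C_pos]] by linarith
    have \<eta>\<eta>: "norm (\<eta>' (g y) v - \<eta>' (g y') v) \<le> 2 * K\<^sup>2 * ?\<delta> * norm v" for v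
    proof -
      have "norm (\<eta>' (g y) v - \<eta>' (g y') v) \<le> K * norm (g y - g y') * norm v"
        by (rule \<eta>'_norm_apply_diff[OF W])
      also have "\<dots> \<le> K * (K * (2 * ?\<delta>)) * norm v"
        using gg K_pos by (intro mult_right_mono mult_left_mono) auto
      finally show ?thesis by (simp add: power2_eq_square mult_ac)
    qed
    have BB: "norm (\<eta>' (g y) (g' y v) - \<eta>' (g y') (g' y' v)) \<le> 2 * (K ^ 3 + K ^ 2) * ?\<delta> * norm v" for v
    proof -
      have "norm (g' y v) \<le> K * norm v"
        by (intro norm_blinfun_le_mult gD(3) Y)
      then have "2 * K\<^sup>2 * ?\<delta> * norm (g' y v) \<le> 2 * K\<^sup>2 * ?\<delta> * (K * norm v)"
        by (intro mult_left_mono) auto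
      then have 1: "norm (\<eta>' (g y) (g' y v) - \<eta>' (g y') (g' y v)) \<le> 2 * K ^ 3 * ?\<delta> * norm v"
        using \<eta>\<eta>[of "g' y v"] by (simp add: power3_eq_cube power2_eq_square mult_ac)
      have "norm ((g' y - g' y') v) \<le> K * (2 * ?\<delta>) * norm v"
      proof -
        have "norm (g' y - g' y') \<le> K * (2 * ?\<delta>)"
          using gD2(2)[OF Y] mult_left_mono[OF yy less_imp_le[OF K_pos]] by linarith
        then show ?thesis by (rule norm_blinfun_le_mult)
      qed
      then have "K * norm ((g' y - g' y') v) \<le> K * (K * (2 * ?\<delta>) * norm v)"
        using K_pos by (intro mult_left_mono) auto
      moreover have "norm (\<eta>' (g y') ((g' y - g' y') v)) \<le> K * norm ((g' y - g' y') v)"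
        by (intro norm_blinfun_le_mult \<eta>D(2) W)
      ultimately have "norm (\<eta>' (g y') ((g' y - g' y') v)) \<le> K * (K * (2 * ?\<delta>) * norm v)"
        by linarith
      then have 2: "norm (\<eta>' (g y') (g' y v) - \<eta>' (g y') (g' y' v)) \<le> 2 * K ^ 2 * ?\<delta> * norm v"
        by (simp add: blinfun.bilinear_simps power2_eq_square mult_ac)
      have "norm (\<eta>' (g y) (g' y v) - \<eta>' (g y') (g' y' v)) \<le> 2 * K ^ 3 * ?\<delta> * norm v + 2 * K ^ 2 * ?\<delta> * norm v"
        by (rule norm_diff_triangle_le[OF 1 2])
      then show ?thesis by (simp add: algebra_simps)
    qed
    have "norm (\<mu> - \<mu>') \<le> C * ((3 + 2 * C * (K ^ 3 + K ^ 2)) * ?\<delta>)"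
    proof (rule \<eta>g_lower_bound[OF Y(1)])
      show "\<mu> - \<mu>' \<in> E" using \<mu>(1) \<mu>'(1) subspace_E by (simp add: subspace_diff)
      fix v
      have "(\<mu> - \<mu>') \<bullet> \<eta>' (g y) (g' y v) =
          ((u - u') - (y - y')) \<bullet> v - \<mu>' \<bullet> (\<eta>' (g y) (g' y v) - \<eta>' (g y') (g' y' v))"
        using s(1)[of v] s(2)[of v] \<mu>(2)[of "g' y v"] \<mu>'(2)[of "g' y' v"]
        by (simp add: inner_diff_left inner_diff_right)
      moreover have "((u - u') - (y - y')) \<bullet> v \<le> (3 * ?\<delta>) * norm v"
      proof -
        have "norm ((u - u') - (y - y')) \<le> 3 * ?\<delta>"
          using norm_triangle_ineq4[of "u - u'" "y - y'"] yy by linarith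
        from abs_inner_le_mult[OF this order_refl, of v] show ?thesis by simp
      qed
      moreover have "\<bar>\<mu>' \<bullet> (\<eta>' (g y) (g' y v) - \<eta>' (g y') (g' y' v))\<bar> \<le>
          C * (2 * (K ^ 3 + K ^ 2) * ?\<delta> * norm v)"
        by (intro abs_inner_le_mult \<mu>'C BB)
      moreover have "((3 + 2 * C * (K ^ 3 + K ^ 2)) * ?\<delta>) * norm v =
          (3 * ?\<delta>) * norm v + C * (2 * (K ^ 3 + K ^ 2) * ?\<delta> * norm v)"
        by (simp add: algebra_simps)
      ultimately show "(\<mu> - \<mu>') \<bullet> \<eta>' (g y) (g' y v) \<le> ((3 + 2 * C * (K ^ 3 + K ^ 2)) * ?\<delta>) * norm v"
        by linarith
    qed
    then have \<mu>\<mu>: "norm (\<mu> - \<mu>') \<le> D * ?\<delta>" unfolding D_def by (simp add: mult_ac)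
    show ?thesis
    proof (rule norm_le_of_inner_le)
      fix v
      have "(\<nu> - \<nu>') \<bullet> v = (\<mu> - \<mu>') \<bullet> \<eta>' (g y) v + \<mu>' \<bullet> (\<eta>' (g y) v - \<eta>' (g y') v)"
        using \<mu>(2)[of v] \<mu>'(2)[of v] by (simp add: inner_diff_left inner_diff_right)
      moreover have "(\<mu> - \<mu>') \<bullet> \<eta>' (g y) v \<le> (D * ?\<delta>) * (K * norm v)"
      proof -
        have "norm (\<eta>' (g y) v) \<le> K * norm v"
          by (intro norm_blinfun_le_mult \<eta>D(2) W)
        from abs_inner_le_mult[OF \<mu>\<mu> this] show ?thesis by simp
      qed
      moreover have "\<mu>' \<bullet> (\<eta>' (g y) v - \<eta>' (g y') v) \<le> C * (2 * K\<^sup>2 * ?\<delta> * norm v)"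
        using abs_inner_le_mult[OF \<mu>'C \<eta>\<eta>] by (rule order_trans[OF abs_ge_self])
      moreover have "L * ?\<delta> * norm v = (D * ?\<delta>) * (K * norm v) + C * (2 * K\<^sup>2 * ?\<delta> * norm v)"
        unfolding L_def by (simp add: algebra_simps)
      ultimately show "(\<nu> - \<nu>') \<bullet> v \<le> L * ?\<delta> * norm v"
        by linarith
    qed (use L in simp)
  qed
  show ?thesis by (intro exI[of _ L] conjI allI impI L main)
qed

text \<open>Normals \<open>\<nu>\<close>, \<open>\<nu>'\<close> at nearby points \<open>a\<close>, \<open>a'\<close> of \<open>\<Theta>\<close> differ, in a direction \<open>d\<close> that is tangential at
  \<open>x\<close>, by terms of the order of \<open>norm (\<nu> - \<nu>') * norm (a - x)\<close> and \<open>norm (a - a')\<close>.\<close>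
lemma normal_difference_tangential:
  assumes a: "a \<in> W" "a \<in> \<Theta>" "\<And>x. x \<in> \<Theta> \<Longrightarrow> \<nu> \<bullet> (x - a) \<le> 0"
    and a': "a' \<in> W" "a' \<in> \<Theta>" "\<And>x. x \<in> \<Theta> \<Longrightarrow> \<nu>' \<bullet> (x - a') \<le> 0"
    and x: "x \<in> W" and d: "\<eta>' x d = 0"
  shows "\<bar>(\<nu> - \<nu>') \<bullet> d\<bar> \<le>
    C * (norm (\<nu> - \<nu>') + C * norm \<nu>' * (K * norm (a - a'))) * (K * norm (a - x) * norm d)
    + C * norm \<nu>' * (K * norm (a - a') * norm d)"
proof -
  obtain \<mu> where \<mu>: "\<mu> \<in> E" "\<And>v. \<nu> \<bullet> v = \<mu> \<bullet> \<eta>' a v"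
    using normal_representation[OF a] by blast
  obtain \<mu>' where \<mu>': "\<mu>' \<in> E" "\<And>v. \<nu>' \<bullet> v = \<mu>' \<bullet> \<eta>' a' v" "norm \<mu>' \<le> C * norm \<nu>'"
    using normal_representation[OF a'] by blast
  have split: "(\<nu> - \<nu>') \<bullet> v = (\<mu> - \<mu>') \<bullet> \<eta>' a v + \<mu>' \<bullet> (\<eta>' a v - \<eta>' a' v)" for v
    using \<mu>(2)[of v] \<mu>'(2)[of v] by (simp add: inner_diff_left inner_diff_right)
  have second: "\<bar>\<mu>' \<bullet> (\<eta>' a v - \<eta>' a' v)\<bar> \<le> C * norm \<nu>' * (K * norm (a - a') * norm v)" for v
    by (intro abs_inner_le_mult \<mu>'(3) \<eta>'_norm_apply_diff a(1) a'(1))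
  have "norm (\<mu> - \<mu>') \<le> C * (norm (\<nu> - \<nu>') + C * norm \<nu>' * (K * norm (a - a')))"
  proof (rule \<eta>_lower_bound[OF a(1)])
    show "\<mu> - \<mu>' \<in> E" using \<mu>(1) \<mu>'(1) subspace_E by (simp add: subspace_diff)
    show "(\<mu> - \<mu>') \<bullet> \<eta>' a v \<le> (norm (\<nu> - \<nu>') + C * norm \<nu>' * (K * norm (a - a'))) * norm v" for v
      using split[of v] second[of v] norm_cauchy_schwarz[of "\<nu> - \<nu>'" v] by (simp add: algebra_simps)
  qed
  moreover have "norm (\<eta>' a d) \<le> K * norm (a - x) * norm d"
    using \<eta>'_norm_apply_diff[OF a(1) x, of d] d by simp
  ultimately have "\<bar>(\<mu> - \<mu>') \<bullet> \<eta>' a d\<bar> \<le>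
      C * (norm (\<nu> - \<nu>') + C * norm \<nu>' * (K * norm (a - a'))) * (K * norm (a - x) * norm d)"
    by (rule abs_inner_le_mult)
  then show ?thesis using split[of d] second[of d] by linarith
qed

lemma closest_point_of_multiplier:
  assumes "multiplier u y \<nu>"
  shows "closest_point \<Theta> (g y + \<nu>) = g y"
  using assms unfolding multiplier_def
  by (intro closest_point_add_normal closed_\<Theta> convex_\<Theta>) auto

end

section \<open>The linearized system and the derivative of the projection\<close>

context regular_constraint
begin

text \<open>With \<open>P\<close> the projection onto \<open>\<Theta>\<close>, the normals \<open>z + t w - P (z + t w)\<close> and \<open>z + t w' - P (z + t w')\<close> have base points that
  agree up to \<open>o(t)\<close>, because both directional derivatives are \<open>p\<close>. Dividing
  \<open>normal_difference_tangential\<close> by \<open>t\<close> leaves only terms that vanish in the limit.\<close>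
lemma dir_deriv_closest_point_tangential:
  assumes z: "closest_point \<Theta> z \<in> W" and ne: "\<Theta> \<noteq> {}"
    and p: "has_dir_deriv (closest_point \<Theta>) z w p" "has_dir_deriv (closest_point \<Theta>) z w' p"
    and d: "\<eta>' (closest_point \<Theta> z) d = 0"
  shows "(w - w') \<bullet> d = 0"
proof -
  let ?P = "closest_point \<Theta>"
  define x where "x = ?P z"
  define a where "a t = ?P (z + t *\<^sub>R w)" for t
  define a' where "a' t = ?P (z + t *\<^sub>R w')" for t
  define q where "q t = (a t - x) /\<^sub>R t" for t
  define q' where "q' t = (a' t - x) /\<^sub>R t" for t
  define \<nu>' where "\<nu>' t = z + t *\<^sub>R w' - a' t" for t
  define R where "R t = (w - w') - (q t - q' t)" for t
  have q: "(q \<longlongrightarrow> p) (at_right 0)" "(q' \<longlongrightarrow> p) (at_right 0)"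
    using p unfolding has_dir_deriv_def q_def q'_def a_def a'_def x_def by auto
  have P: "isCont ?P z"
    by (rule continuous_at_closest_point[OF convex_\<Theta> closed_\<Theta> ne])
  have "((\<lambda>t. z + t *\<^sub>R w) \<longlongrightarrow> z + 0 *\<^sub>R w) (at_right 0)" "((\<lambda>t. z + t *\<^sub>R w') \<longlongrightarrow> z + 0 *\<^sub>R w') (at_right 0)"
    by (intro tendsto_intros)+
  then have zt: "((\<lambda>t. z + t *\<^sub>R w) \<longlongrightarrow> z) (at_right 0)" "((\<lambda>t. z + t *\<^sub>R w') \<longlongrightarrow> z) (at_right 0)"
    by simp_all
  have a: "(a \<longlongrightarrow> x) (at_right 0)" "(a' \<longlongrightarrow> x) (at_right 0)"
    unfolding a_def[abs_def] a'_def[abs_def] x_def by (intro isCont_tendsto_compose[OF P] zt)+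
  have \<nu>': "(\<nu>' \<longlongrightarrow> z - x) (at_right 0)"
    unfolding \<nu>'_def[abs_def] by (intro tendsto_intros zt a)
  have R: "(R \<longlongrightarrow> (w - w') - (p - p)) (at_right 0)"
    unfolding R_def[abs_def] by (intro tendsto_intros q)
  have inW: "\<forall>\<^sub>F t in at_right 0. a t \<in> W" "\<forall>\<^sub>F t in at_right 0. a' t \<in> W"
    using topological_tendstoD[OF a(1) open_W] topological_tendstoD[OF a(2) open_W] z unfolding x_def by auto
  let ?rhs = "\<lambda>t. C * (norm (R t) + C * norm (\<nu>' t) * (K * norm (q t - q' t))) * (K * norm (a t - x) * norm d)
      + C * norm (\<nu>' t) * (K * norm (q t - q' t) * norm d)"
  have ev: "\<forall>\<^sub>F t in at_right 0. \<bar>R t \<bullet> d\<bar> \<le> ?rhs t"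
    using inW eventually_at_right_less[of "0::real"]
  proof eventually_elim
    case (elim t)
    let ?\<nu> = "z + t *\<^sub>R w - a t"
    have "\<bar>(?\<nu> - \<nu>' t) \<bullet> d\<bar> \<le>
      C * (norm (?\<nu> - \<nu>' t) + C * norm (\<nu>' t) * (K * norm (a t - a' t))) * (K * norm (a t - x) * norm d)
      + C * norm (\<nu>' t) * (K * norm (a t - a' t) * norm d)"
    proof (rule normal_difference_tangential)
      show "a t \<in> \<Theta>" "a' t \<in> \<Theta>"
        unfolding a_def a'_def using closest_point_in_set[OF closed_\<Theta> ne] by auto
      show "?\<nu> \<bullet> (x - a t) \<le> 0" "\<nu>' t \<bullet> (x - a' t) \<le> 0" if "x \<in> \<Theta>" for x
        unfolding a_def a'_def \<nu>'_def using closest_point_dot[OF convex_\<Theta> closed_\<Theta> that] by auto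
      show "x \<in> W" "\<eta>' x d = 0" using z d unfolding x_def by auto
    qed (use elim in auto)
    moreover have "?\<nu> - \<nu>' t = t *\<^sub>R R t" "a t - a' t = t *\<^sub>R (q t - q' t)"
      using elim unfolding \<nu>'_def R_def q_def q'_def by (simp_all add: algebra_simps)
    ultimately have "t * \<bar>R t \<bullet> d\<bar> \<le>
      C * (t * norm (R t) + C * norm (\<nu>' t) * (K * (t * norm (q t - q' t)))) * (K * norm (a t - x) * norm d)
      + C * norm (\<nu>' t) * (K * (t * norm (q t - q' t)) * norm d)"
      using elim by (simp add: abs_mult)
    also have "\<dots> = t * ?rhs t" by (simp add: algebra_simps)
    finally show ?case by (rule mult_left_le_imp_le) (rule elim(3))
  qed
  have lim: "((\<lambda>t. \<bar>R t \<bullet> d\<bar>) \<longlongrightarrow> \<bar>((w - w') - (p - p)) \<bullet> d\<bar>) (at_right 0)"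
    by (intro tendsto_intros R)
  have rhs: "(?rhs \<longlongrightarrow> C * (norm ((w - w') - (p - p)) + C * norm (z - x) * (K * norm (p - p))) * (K * norm (x - x) * norm d)
      + C * norm (z - x) * (K * norm (p - p) * norm d)) (at_right 0)"
    by (intro tendsto_intros R \<nu>' q a)
  show ?thesis
    using tendsto_le[OF trivial_limit_at_right_real rhs lim ev] by simp
qed

lemma solves_unique:
  assumes m: "multiplier u y \<nu>" and small: "K * norm \<nu> \<le> 1 / 4"
    and v: "solves y \<nu> h v" and v': "solves y \<nu> h v'"
  shows "v = v'"
proof -
  obtain v1 v2 w1 w2 where vw: "v = (v1, v2)" "v' = (w1, w2)" by (cases v, cases v') auto
  define d1 where "d1 = v1 - w1"
  define d2 where "d2 = v2 - w2"
  have y: "y \<in> Y" and ne: "\<Theta> \<noteq> {}" using m unfolding multiplier_def by auto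
  have eqs: "\<And>d. h \<bullet> d = v1 \<bullet> d + \<nu> \<bullet> g'' y v1 d + v2 \<bullet> g' y d"
      "\<And>d. h \<bullet> d = w1 \<bullet> d + \<nu> \<bullet> g'' y w1 d + w2 \<bullet> g' y d"
    and P: "has_dir_deriv (closest_point \<Theta>) (g y + \<nu>) (g' y v1 + v2) (g' y v1)"
      "has_dir_deriv (closest_point \<Theta>) (g y + \<nu>) (g' y w1 + w2) (g' y w1)"
    using v v' unfolding vw solves_def by auto
  have diff: "d1 \<bullet> d + \<nu> \<bullet> g'' y d1 d + d2 \<bullet> g' y d = 0" for d
    using eqs[of d] unfolding d1_def d2_def by (simp add: blinfun.bilinear_simps inner_diff_left inner_diff_right)
  \<comment> \<open>Monotonicity of the directional derivative applies to its increment \<open>g' y d1\<close> and the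
      increment \<open>d2\<close> of the residual.\<close>
  have "0 \<le> d2 \<bullet> g' y d1"
    using dir_deriv_closest_point_monotone[OF closed_\<Theta> convex_\<Theta> ne P] unfolding d1_def d2_def
    by (simp add: blinfun.bilinear_simps inner_commute)
  moreover have "\<bar>\<nu> \<bullet> g'' y d1 d1\<bar> \<le> norm \<nu> * ((K * norm d1) * norm d1)"
    by (intro abs_inner_le_mult norm_blinfun_le_mult gD(4) y order_refl)
  moreover have "norm \<nu> * ((K * norm d1) * norm d1) \<le> 1 / 4 * (norm d1)\<^sup>2"
    using mult_right_mono[OF small, of "(norm d1)\<^sup>2"] by (simp add: mult_ac power2_eq_square)
  ultimately have "(norm d1)\<^sup>2 \<le> 1 / 4 * (norm d1)\<^sup>2"
    using diff[of d1] by (simp add: power2_norm_eq_inner)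
  then have d1: "d1 = 0" by simp
  then have ran: "d2 \<bullet> g' y d = 0" for d using diff[of d] by (simp add: blinfun.bilinear_simps)
  have "d2 = 0"
  proof (rule separation[OF y _ ran])
    fix d assume d: "\<eta>' (g y) d = 0"
    have "((g' y v1 + v2) - (g' y w1 + w2)) \<bullet> d = 0"
    proof (rule dir_deriv_closest_point_tangential[where z="g y + \<nu>" and p="g' y v1"])
      show "has_dir_deriv (closest_point \<Theta>) (g y + \<nu>) (g' y w1 + w2) (g' y v1)"
        using P(2) d1 unfolding d1_def by simp
    qed (use closest_point_of_multiplier[OF m] gD(5)[OF y] ne P(1) d in auto)
    then show "d2 \<bullet> d = 0" using d1 unfolding d1_def d2_def by simp
  qed
  then show ?thesis using d1 unfolding d1_def d2_def vw by simp
qed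

text \<open>Limits of difference quotients along a sequence of step sizes solve the linearized system.\<close>
lemma limit_solves:
  assumes dd: "\<And>z w. \<exists>p. has_dir_deriv (closest_point \<Theta>) z w p"
    and m: "multiplier u y \<nu>"
    and T: "\<And>k. 0 < T k" "T \<longlonglongrightarrow> 0"
    and mT: "\<forall>\<^sub>F k in sequentially. multiplier (u + T k *\<^sub>R h) (y' k) (\<nu>' k)"
    and v1: "(\<lambda>k. (y' k - y) /\<^sub>R T k) \<longlonglongrightarrow> v1" and v2: "(\<lambda>k. (\<nu>' k - \<nu>) /\<^sub>R T k) \<longlonglongrightarrow> v2"
  shows "solves y \<nu> h (v1, v2)"
proof -
  let ?P = "closest_point \<Theta>"
  have y: "y \<in> Y" and ne: "\<Theta> \<noteq> {}" using m unfolding multiplier_def by auto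
  have Tpos: "\<forall>\<^sub>F k in sequentially. 0 < T k" using T(1) by simp
  have Dg: "(\<lambda>k. (g (y' k) - g y) /\<^sub>R T k) \<longlonglongrightarrow> g' y v1"
    by (rule difference_quotient_tendsto[OF gD(1)[OF y] T(2) Tpos v1])
  have Dg': "(\<lambda>k. (g' (y' k) - g' y) /\<^sub>R T k) \<longlonglongrightarrow> g'' y v1"
    by (rule difference_quotient_tendsto[OF gD(2)[OF y] T(2) Tpos v1])
  have g'y: "(\<lambda>k. g' (y' k)) \<longlonglongrightarrow> g' y"
    by (rule tendsto_of_quotient_tendsto[OF T(2) Tpos Dg'])
  have "h \<bullet> d = v1 \<bullet> d + \<nu> \<bullet> g'' y v1 d + v2 \<bullet> g' y d" for d
  proof -
    have "(\<lambda>k. ((y' k - y) /\<^sub>R T k) \<bullet> d + \<nu> \<bullet> ((g' (y' k) - g' y) /\<^sub>R T k) d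
        + ((\<nu>' k - \<nu>) /\<^sub>R T k) \<bullet> g' (y' k) d) \<longlonglongrightarrow> v1 \<bullet> d + \<nu> \<bullet> g'' y v1 d + v2 \<bullet> g' y d"
      by (intro tendsto_intros v1 v2 Dg' g'y)
    moreover have "\<forall>\<^sub>F k in sequentially. ((y' k - y) /\<^sub>R T k) \<bullet> d + \<nu> \<bullet> ((g' (y' k) - g' y) /\<^sub>R T k) d
        + ((\<nu>' k - \<nu>) /\<^sub>R T k) \<bullet> g' (y' k) d = h \<bullet> d"
      using mT
    proof eventually_elim
      case (elim k)
      have "(u + T k *\<^sub>R h - y' k) \<bullet> d = \<nu>' k \<bullet> g' (y' k) d" "(u - y) \<bullet> d = \<nu> \<bullet> g' y d"
        using elim m unfolding multiplier_def by auto
      then have "T k * (h \<bullet> d) = (y' k - y) \<bullet> d + \<nu> \<bullet> (g' (y' k) - g' y) d + (\<nu>' k - \<nu>) \<bullet> g' (y' k) d"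
        by (simp add: inner_diff_left inner_add_left inner_diff_right blinfun.bilinear_simps)
      then have "h \<bullet> d = ((y' k - y) \<bullet> d + \<nu> \<bullet> (g' (y' k) - g' y) d + (\<nu>' k - \<nu>) \<bullet> g' (y' k) d) / T k"
        using T(1)[of k] by (simp add: field_simps)
      then show ?case
        by (simp add: blinfun.scaleR_left add_divide_distrib divide_inverse_commute distrib_left)
    qed
    then have "(\<lambda>k. ((y' k - y) /\<^sub>R T k) \<bullet> d + \<nu> \<bullet> ((g' (y' k) - g' y) /\<^sub>R T k) d
        + ((\<nu>' k - \<nu>) /\<^sub>R T k) \<bullet> g' (y' k) d) \<longlonglongrightarrow> h \<bullet> d"
      by (rule tendsto_eventually)
    ultimately show ?thesis by (rule LIMSEQ_unique[rotated])
  qed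
  moreover have "has_dir_deriv ?P (g y + \<nu>) (g' y v1 + v2) (g' y v1)"
  proof -
    let ?w = "g' y v1 + v2" and ?z = "g y + \<nu>"
    obtain p where p: "has_dir_deriv ?P ?z ?w p" using dd by blast
    have "filterlim T (at_right 0) sequentially"
      using T unfolding filterlim_at by (auto intro!: always_eventually simp: less_imp_neq[symmetric])
    then have Pw: "(\<lambda>k. (?P (?z + T k *\<^sub>R ?w) - ?P ?z) /\<^sub>R T k) \<longlonglongrightarrow> p"
      using p unfolding has_dir_deriv_def by (rule filterlim_compose[rotated])
    \<comment> \<open>Since \<open>g (y' k) = ?P (g (y' k) + \<nu>' k)\<close> and \<open>?P\<close> is nonexpansive, the quotients of \<open>g \<circ> y'\<close>
      and of \<open>?P\<close> along the fixed direction \<open>?w\<close> have the same limit.\<close>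
    have "(\<lambda>k. (g (y' k) - g y) /\<^sub>R T k - (?P (?z + T k *\<^sub>R ?w) - ?P ?z) /\<^sub>R T k) \<longlonglongrightarrow> 0"
    proof (rule tendsto_norm_zero_cancel, rule tendsto_sandwich[OF _ _ tendsto_const])
      have "(\<lambda>k. norm ((g (y' k) - g y) /\<^sub>R T k + (\<nu>' k - \<nu>) /\<^sub>R T k - ?w)) \<longlonglongrightarrow> norm (g' y v1 + v2 - ?w)"
        by (intro tendsto_intros Dg v2)
      then show "(\<lambda>k. norm ((g (y' k) - g y) /\<^sub>R T k + (\<nu>' k - \<nu>) /\<^sub>R T k - ?w)) \<longlonglongrightarrow> 0" by simp
      show "\<forall>\<^sub>F k in sequentially. norm ((g (y' k) - g y) /\<^sub>R T k - (?P (?z + T k *\<^sub>R ?w) - ?P ?z) /\<^sub>R T k)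
          \<le> norm ((g (y' k) - g y) /\<^sub>R T k + (\<nu>' k - \<nu>) /\<^sub>R T k - ?w)"
        using mT
      proof eventually_elim
        case (elim k)
        have "(g (y' k) - g y) /\<^sub>R T k - (?P (?z + T k *\<^sub>R ?w) - ?P ?z) /\<^sub>R T k
            = (?P (g (y' k) + \<nu>' k) - ?P (?z + T k *\<^sub>R ?w)) /\<^sub>R T k"
          unfolding closest_point_of_multiplier[OF m] closest_point_of_multiplier[OF elim]
          by (simp add: scaleR_diff_right)
        then have "norm ((g (y' k) - g y) /\<^sub>R T k - (?P (?z + T k *\<^sub>R ?w) - ?P ?z) /\<^sub>R T k)
            = norm (?P (g (y' k) + \<nu>' k) - ?P (?z + T k *\<^sub>R ?w)) / T k"
          using T(1)[of k] by (simp add: divide_inverse_commute)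
        also have "\<dots> \<le> norm ((g (y' k) + \<nu>' k) - (?z + T k *\<^sub>R ?w)) / T k"
          using closest_point_lipschitz[OF convex_\<Theta> closed_\<Theta> ne] T(1)[of k]
          by (intro divide_right_mono) (auto simp: dist_norm less_imp_le)
        also have "\<dots> = norm (((g (y' k) + \<nu>' k) - (?z + T k *\<^sub>R ?w)) /\<^sub>R T k)"
          using T(1)[of k] by (simp add: divide_inverse_commute)
        also have "((g (y' k) + \<nu>' k) - (?z + T k *\<^sub>R ?w)) /\<^sub>R T k = (g (y' k) - g y) /\<^sub>R T k + (\<nu>' k - \<nu>) /\<^sub>R T k - ?w"
          using T(1)[of k] by (simp add: algebra_simps)
        finally show ?case .
      qed
    qed simp
    from tendsto_diff[OF Dg this]
    have "(\<lambda>k. (?P (?z + T k *\<^sub>R ?w) - ?P ?z) /\<^sub>R T k) \<longlonglongrightarrow> g' y v1" by simp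
    then have "p = g' y v1" using LIMSEQ_unique Pw by blast
    then show ?thesis using p by simp
  qed
  ultimately show ?thesis unfolding solves_def by simp
qed

lemma projection_has_dir_deriv:
  assumes dd: "\<And>z w. \<exists>p. has_dir_deriv (closest_point \<Theta>) z w p"
    and U: "open U" "u \<in> U"
    and sel: "\<And>u. u \<in> U \<Longrightarrow> multiplier u (y u) (\<nu> u)"
      "\<And>u. u \<in> U \<Longrightarrow> K * norm (\<nu> u) \<le> 1 / 4" "\<And>u. u \<in> U \<Longrightarrow> norm (u - y u) \<le> 1"
  shows "\<exists>v. solves (y u) (\<nu> u) h v \<and> has_dir_deriv y u h (fst v)"
proof -
  obtain L where L: "L \<ge> 0" "\<And>u u'. u \<in> U \<Longrightarrow> u' \<in> U \<Longrightarrow> norm (\<nu> u - \<nu> u') \<le> L * norm (u - u')"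
    using multiplier_lipschitz sel by metis
  define Q where "Q t = ((y (u + t *\<^sub>R h) - y u) /\<^sub>R t, (\<nu> (u + t *\<^sub>R h) - \<nu> u) /\<^sub>R t)" for t
  have "((\<lambda>t. u + t *\<^sub>R h) \<longlongrightarrow> u + 0 *\<^sub>R h) (nhds 0)"
    by (intro tendsto_intros) (simp add: filterlim_ident)
  then have nhdsU: "\<forall>\<^sub>F t in nhds 0. u + t *\<^sub>R h \<in> U"
    using topological_tendstoD[OF _ U(1)] U(2) by fastforce
  have bdd: "\<forall>\<^sub>F t in at_right 0. norm (Q t) \<le> 2 * norm h + L * norm h"
    using eventually_nhds_conv_at[THEN iffD1, OF nhdsU, THEN conjunct1, THEN filter_leD[OF at_le[OF subset_UNIV]]]
      eventually_at_right_less[of "0::real"]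
  proof eventually_elim
    case (elim t)
    have quot: "norm (x /\<^sub>R t) = norm x / t" for x :: "'x::real_normed_vector"
      using elim(2) by (simp add: divide_inverse_commute)
    have "norm (y (u + t *\<^sub>R h) - y u) \<le> 2 * norm (t *\<^sub>R h)"
      using projection_lipschitz[OF sel(1)[OF elim(1)] sel(1)[OF U(2)] sel(2)[OF elim(1)] sel(2)[OF U(2)]] by simp
    then have 1: "norm ((y (u + t *\<^sub>R h) - y u) /\<^sub>R t) \<le> 2 * norm h"
      unfolding quot using elim(2) by (simp add: pos_divide_le_eq mult_ac)
    have "norm (\<nu> (u + t *\<^sub>R h) - \<nu> u) \<le> L * norm (t *\<^sub>R h)"
      using L(2)[OF elim(1) U(2)] by simp
    then have 2: "norm ((\<nu> (u + t *\<^sub>R h) - \<nu> u) /\<^sub>R t) \<le> L * norm h"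
      unfolding quot using elim(2) by (simp add: pos_divide_le_eq mult_ac)
    show ?case unfolding Q_def using norm_Pair_le[of "(y (u + t *\<^sub>R h) - y u) /\<^sub>R t" "(\<nu> (u + t *\<^sub>R h) - \<nu> u) /\<^sub>R t"] 1 2
      by linarith
  qed
  have "\<exists>v. solves (y u) (\<nu> u) h v \<and> (Q \<longlongrightarrow> v) (at_right 0)"
  proof (rule tendsto_at_right_unique_cluster[OF bdd])
    fix T :: "nat \<Rightarrow> real" and v
    assume T: "\<And>k. 0 < T k" "T \<longlonglongrightarrow> 0" and v: "(\<lambda>k. Q (T k)) \<longlonglongrightarrow> v"
    have "solves (y u) (\<nu> u) h (fst v, snd v)"
    proof (rule limit_solves[OF dd sel(1)[OF U(2)] T])
      have "\<forall>\<^sub>F k in sequentially. u + T k *\<^sub>R h \<in> U"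
        by (rule eventually_compose_filterlim[OF nhdsU T(2)])
      then show "\<forall>\<^sub>F k in sequentially. multiplier (u + T k *\<^sub>R h) (y (u + T k *\<^sub>R h)) (\<nu> (u + T k *\<^sub>R h))"
        by eventually_elim (rule sel(1))
      show "(\<lambda>k. (y (u + T k *\<^sub>R h) - y u) /\<^sub>R T k) \<longlonglongrightarrow> fst v"
        "(\<lambda>k. (\<nu> (u + T k *\<^sub>R h) - \<nu> u) /\<^sub>R T k) \<longlonglongrightarrow> snd v"
        using tendsto_fst[OF v] tendsto_snd[OF v] unfolding Q_def by simp_all
    qed
    then show "solves (y u) (\<nu> u) h v" by simp
  next
    show "v = v'" if "solves (y u) (\<nu> u) h v" "solves (y u) (\<nu> u) h v'" for v v'
      using solves_unique[OF sel(1,2)[OF U(2)]] that by blast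
  qed
  then obtain v where "solves (y u) (\<nu> u) h v" "(Q \<longlongrightarrow> v) (at_right 0)" by blast
  then show ?thesis
    using tendsto_fst[of Q v] unfolding has_dir_deriv_def Q_def by fastforce
qed

text \<open>On a small ball about \<open>y0\<close> every point has its projections in \<open>Y\<close>, with multipliers that satisfy
  \<open>K * norm \<nu> \<le> 1 / 4\<close>.\<close>
theorem local_projection:
  assumes dd: "\<And>z w. \<exists>p. has_dir_deriv (closest_point \<Theta>) z w p"
    and y0: "y0 \<in> Y" "g y0 \<in> \<Theta>" and cl: "closed (g -` \<Theta>)"
  shows "\<exists>U. open U \<and> y0 \<in> U \<and> (\<forall>u\<in>U. (\<exists>!y. y \<in> metric_projection (g -` \<Theta>) u) \<and>
     (\<exists>!\<nu>. multiplier u (closest_point (g -` \<Theta>) u) \<nu>) \<and>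
     (\<forall>\<nu> h. multiplier u (closest_point (g -` \<Theta>) u) \<nu> \<longrightarrow>
        (\<exists>!v. solves (closest_point (g -` \<Theta>) u) \<nu> h v) \<and>
        (\<forall>v. solves (closest_point (g -` \<Theta>) u) \<nu> h v \<longrightarrow>
           has_dir_deriv (closest_point (g -` \<Theta>)) u h (fst v))))"
proof -
  let ?\<Gamma> = "g -` \<Theta>"
  let ?P = "closest_point ?\<Gamma>"
  have ne: "?\<Gamma> \<noteq> {}" using y0 by auto
  obtain r where r: "r > 0" "ball y0 r \<subseteq> Y" using open_Y y0(1) open_contains_ball by blast
  \<comment> \<open>A point within \<open>e\<close> of \<open>y0\<close> has its projections within \<open>2 * e\<close> of \<open>y0\<close>, and the third bound
    makes \<open>K\<close> times the norm of the multiplier at most \<open>1 / 4\<close>.\<close>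
  define e where "e = min (r / 2) (min 1 (1 / (4 * (C * K * K))))"
  have e: "e > 0" "2 * e \<le> r" "e \<le> 1" "C * K * K * e \<le> 1 / 4"
  proof -
    show "e > 0" unfolding e_def using r(1) C_pos K_pos by simp
    show "2 * e \<le> r" "e \<le> 1" unfolding e_def by auto
    have "e \<le> 1 / (4 * (C * K * K))" unfolding e_def by simp
    then show "C * K * K * e \<le> 1 / 4" using C_pos K_pos by (simp add: field_simps)
  qed
  define U where "U = ball y0 e"
  have near: "y \<in> Y" "norm (u - y) < e" if u: "u \<in> U" and y: "y \<in> metric_projection ?\<Gamma> u" for u y
  proof -
    have "dist u y \<le> dist u y0" using y y0 unfolding metric_projection_def by simp
    then have *: "dist u y < e" using u unfolding U_def by (simp add: dist_commute)
    then show "norm (u - y) < e" by (simp add: dist_norm)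
    have "dist y0 y \<le> dist y0 u + dist u y" by (rule dist_triangle)
    then have "dist y0 y < r" using * u e(2) unfolding U_def by simp
    then show "y \<in> Y" using r(2) by auto
  qed
  have small: "K * norm \<nu> \<le> 1 / 4" if "multiplier u y \<nu>" "norm (u - y) < e" for u y \<nu>
  proof -
    have "K * norm \<nu> \<le> K * (C * K * norm (u - y))"
      using multiplier_norm_le[OF that(1)] K_pos by simp
    also have "\<dots> \<le> K * (C * K * e)"
      using that(2) K_pos C_pos by simp
    also have "\<dots> \<le> 1 / 4" using e(4) by (simp add: mult_ac)
    finally show ?thesis .
  qed
  have P: "?P u \<in> metric_projection ?\<Gamma> u" for u
    unfolding metric_projection_def
    using closest_point_in_set[OF cl ne] closest_point_le[OF cl] by auto
  define \<nu> where "\<nu> u = (SOME \<nu>. multiplier u (?P u) \<nu>)" for u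
  have \<nu>: "multiplier u (?P u) (\<nu> u)" if "u \<in> U" for u
    unfolding \<nu>_def by (rule someI_ex) (rule projection_multiplier[OF P near(1)[OF that P]])
  have unique: "y = ?P u" if u: "u \<in> U" and y: "y \<in> metric_projection ?\<Gamma> u" for u y
  proof -
    obtain \<nu>1 where \<nu>1: "multiplier u y \<nu>1" using projection_multiplier[OF y near(1)[OF u y]] by blast
    have "norm (y - ?P u) \<le> 2 * norm (u - u)"
      by (rule projection_lipschitz[OF \<nu>1 \<nu>[OF u] small[OF \<nu>1 near(2)[OF u y]] small[OF \<nu>[OF u] near(2)[OF u P]]])
    then show ?thesis by simp
  qed
  have deriv: "\<exists>v. solves (?P u) (\<nu> u) h v \<and> has_dir_deriv ?P u h (fst v)" if u: "u \<in> U" for u h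
  proof (rule projection_has_dir_deriv[OF dd _ u])
    show "open U" unfolding U_def by simp
    show "multiplier u (?P u) (\<nu> u)" "K * norm (\<nu> u) \<le> 1 / 4" "norm (u - ?P u) \<le> 1" if "u \<in> U" for u
      using \<nu>[OF that] small[OF \<nu>[OF that] near(2)[OF that P]] near(2)[OF that P] e(3) by auto
  qed
  show ?thesis
  proof (intro exI[of _ U] conjI ballI allI impI)
    show "open U" "y0 \<in> U" unfolding U_def using e(1) by auto
    fix u assume u: "u \<in> U"
    show "\<exists>!y. y \<in> metric_projection ?\<Gamma> u" using P unique[OF u] by blast
    show "\<exists>!\<nu>. multiplier u (?P u) \<nu>" using \<nu>[OF u] multiplier_unique by blast
    fix \<nu>1 h assume "multiplier u (?P u) \<nu>1"
    then have \<nu>1: "\<nu>1 = \<nu> u" using \<nu>[OF u] multiplier_unique by blast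
    obtain v where v: "solves (?P u) (\<nu> u) h v" "has_dir_deriv ?P u h (fst v)" using deriv[OF u] by blast
    have uniq: "v' = v" if "solves (?P u) (\<nu> u) h v'" for v'
      by (rule solves_unique[OF \<nu>[OF u] small[OF \<nu>[OF u] near(2)[OF u P]] that v(1)])
    show "\<exists>!v. solves (?P u) \<nu>1 h v" unfolding \<nu>1 using v(1) uniq by blast
    show "has_dir_deriv ?P u h (fst v')" if "solves (?P u) \<nu>1 h v'" for v'
      using uniq[OF that[unfolded \<nu>1]] v(2) by simp
  qed
qed

end

section \<open>Existence of regular constraint systems\<close>

text \<open>Reducibility and nondegeneracy at a single point provide a regular constraint system on
  neighborhoods of that point and of its image.\<close>
lemma regular_constraint_near:
  fixes g :: "'a::euclidean_space \<Rightarrow> 'b::euclidean_space" and \<eta> :: "'b \<Rightarrow> 'c::euclidean_space"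
  assumes \<Theta>: "closed \<Theta>" "convex \<Theta>" and \<Xi>: "convex \<Xi>" "\<Xi> \<subseteq> E" and E: "subspace E"
    and g: "\<And>x. (g has_derivative blinfun_apply (g' x)) (at x)"
      "\<And>x. (g' has_derivative blinfun_apply (g'' x)) (at x)" "continuous_on UNIV g''"
    and V: "open V" "g y0 \<in> V"
    and \<eta>: "\<And>z. z \<in> V \<Longrightarrow> (\<eta> has_derivative blinfun_apply (\<eta>' z)) (at z)"
      "\<And>z. z \<in> V \<Longrightarrow> (\<eta>' has_derivative blinfun_apply (\<eta>'' z)) (at z)" "continuous_on V \<eta>''"
    and \<eta>E: "\<eta> ` V \<subseteq> E" "range (\<eta>' (g y0)) = E"
    and iff: "\<And>z. z \<in> V \<Longrightarrow> z \<in> \<Theta> \<longleftrightarrow> \<eta> z \<in> \<Xi>"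
    and nondeg: "\<And>s. \<exists>v d. s = g' y0 v + d \<and> \<eta>' (g y0) d = 0"
  shows "\<exists>Y W K C. y0 \<in> Y \<and> regular_constraint g g' g'' \<eta> \<eta>' \<eta>'' \<Theta> \<Xi> E Y W K C"
proof -
  let ?z = "g y0"
  obtain r1 K1 where r1: "r1 > 0" "K1 > 0" "cball ?z r1 \<subseteq> V" "second_order_bounds \<eta> \<eta>' \<eta>'' (cball ?z r1) K1"
    using second_order_bounds_exist[OF V \<eta>] by metis
  have cont: "continuous_on V \<eta>'"
    using \<eta>(2) by (meson has_derivative_continuous continuous_at_imp_continuous_on)
  have sub: "range (\<eta>' z) \<subseteq> E" if "z \<in> V" for z
    by (rule range_derivative_subset[OF V(1) that \<eta>(1)[OF that] E \<eta>E(1)])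
  obtain r2 C1 where r2: "r2 > 0" "C1 > 0" "ball ?z r2 \<subseteq> V" "uniformly_onto \<eta>' (ball ?z r2) E C1"
    using uniformly_onto_nearby[OF V cont E \<eta>E(2) sub] by metis
  define W where "W = ball ?z (min r1 r2)"
  have W: "open W" "?z \<in> W" "W \<subseteq> V" "W \<subseteq> cball ?z r1" "W \<subseteq> ball ?z r2"
    unfolding W_def using r1 r2 by auto
  have contg: "continuous_on UNIV g" "continuous_on UNIV g'"
    using g by (meson has_derivative_continuous continuous_at_imp_continuous_on)+
  define Y0 where "Y0 = g -` W"
  have Y0: "open Y0" "y0 \<in> Y0"
    unfolding Y0_def using W contg(1) by (auto intro: open_vimage)
  let ?G = "\<lambda>y. \<eta>' (g y) o\<^sub>L g' y"
  have contG: "continuous_on Y0 ?G"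
  proof (intro continuous_intros)
    show "continuous_on Y0 (\<lambda>y. \<eta>' (g y))"
      by (rule continuous_on_compose2[OF cont continuous_on_subset[OF contg(1)]])
         (use W(3) in \<open>auto simp: Y0_def\<close>)
    show "continuous_on Y0 g'" by (rule continuous_on_subset[OF contg(2)]) simp
  qed
  have rangeG: "range (?G y0) = E"
  proof -
    have "\<eta>' ?z s \<in> range (?G y0)" for s
    proof -
      obtain v d where "s = g' y0 v + d" "\<eta>' ?z d = 0" using nondeg by blast
      then have "\<eta>' ?z s = ?G y0 v" by (simp add: blinfun.bilinear_simps)
      then show ?thesis by (rule range_eqI)
    qed
    then show ?thesis using \<eta>E(2) by auto
  qed
  have subG: "range (?G y) \<subseteq> E" if "y \<in> Y0" for y
    using sub[of "g y"] that W(3) unfolding Y0_def by auto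
  obtain r3 C2 where r3: "r3 > 0" "C2 > 0" "ball y0 r3 \<subseteq> Y0" "uniformly_onto ?G (ball y0 r3) E C2"
    using uniformly_onto_nearby[OF Y0 contG E rangeG subG] by metis
  obtain r4 K2 where r4: "r4 > 0" "K2 > 0" "second_order_bounds g g' g'' (cball y0 r4) K2"
    using second_order_bounds_exist[OF open_UNIV UNIV_I g] by metis
  define Y where "Y = ball y0 (min r3 r4)"
  have Y: "Y \<subseteq> ball y0 r3" "Y \<subseteq> cball y0 r4" "y0 \<in> Y" "open Y"
    unfolding Y_def using r3 r4 by auto
  have "regular_constraint g g' g'' \<eta> \<eta>' \<eta>'' \<Theta> \<Xi> E Y W (max K1 K2) (max C1 C2)"
  proof
    show "g ` Y \<subseteq> W" using Y(1) r3(3) unfolding Y0_def by auto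
    show "second_order_bounds g g' g'' Y (max K1 K2)"
      using r4(3) Y(2) by (rule second_order_bounds_mono) simp
    show "second_order_bounds \<eta> \<eta>' \<eta>'' W (max K1 K2)"
      using r1(4) W(4) by (rule second_order_bounds_mono) simp
    show "uniformly_onto \<eta>' W E (max C1 C2)"
      using r2(4) W(5) r2(2) by (rule uniformly_onto_mono) simp
    show "uniformly_onto ?G Y E (max C1 C2)"
      using r3(4) Y(1) r3(2) by (rule uniformly_onto_mono) simp
    show "\<eta> ` W \<subseteq> E" using \<eta>E(1) W(3) by blast
    show "z \<in> \<Theta> \<longleftrightarrow> \<eta> z \<in> \<Xi>" if "z \<in> W" for z using iff W(3) that by blast
    show "open W" "open Y" by (fact W(1), fact Y(4))
    show "0 < max K1 K2" "0 < max C1 C2" using r1(2) r2(2) by (simp_all add: less_max_iff_disj)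
  qed (fact \<Theta> \<Xi> E)+
  then show ?thesis using Y(3) by blast
qed

section \<open>Jacobians, Hessians, and the projection theorem\<close>

lemma jacobian_mult_eq:
  fixes f :: "real^'m \<Rightarrow> real^'l"
  assumes "(f has_derivative f') (at x)"
  shows "(*v) (jacobian f (at x)) = f'"
proof -
  have "f differentiable (at x)" using assms by (rule differentiableI)
  then have "(f has_derivative (*v) (jacobian f (at x))) (at x)" by (simp add: jacobian_works)
  then show ?thesis using assms by (rule has_derivative_unique)
qed

lemma inner_transpose_mult:
  fixes A :: "real^'m^'l"
  shows "(transpose A *v \<nu>) \<bullet> v = \<nu> \<bullet> (A *v v)"
  by (simp add: transpose_matrix_vector dot_lmul_matrix)

lemma sum_matrix_vector_mult:
  fixes M :: "'i \<Rightarrow> real^'m^'l"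
  shows "(\<Sum>i\<in>I. M i) *v x = (\<Sum>i\<in>I. M i *v x)"
  by (induction I rule: infinite_finite_induct)
     (simp_all add: matrix_vector_mult_add_rdistrib)

text \<open>The weighted sum of Hessians is the second derivative of \<open>g\<close> tested with \<open>\<nu>\<close>. The Hessian is the
  Jacobian of the gradient, so \<open>v\<close> is the direction of the outer derivative and no symmetry is
  needed.\<close>
lemma inner_hessian_combination:
  fixes g :: "real^'m \<Rightarrow> real^'l"
  assumes g': "\<And>x. (g has_derivative blinfun_apply (g' x)) (at x)"
    and g'': "(g' has_derivative blinfun_apply (g'' y)) (at y)"
  shows "((\<Sum>i\<in>UNIV. (\<nu> $ i) *\<^sub>R hessian (\<lambda>x. g x $ i) y) *v v) \<bullet> d = \<nu> \<bullet> g'' y v d"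
proof -
  have grad: "gradient (\<lambda>x. g x $ i) x = (\<chi> j. g' x (axis j 1) $ i)" for i x
  proof -
    have "((\<lambda>x. g x $ i) has_derivative (\<lambda>v. g' x v $ i)) (at x)"
      using bounded_linear.has_derivative[OF bounded_linear_vec_nth g'] .
    then have "frechet_derivative (\<lambda>x. g x $ i) (at x) = (\<lambda>v. g' x v $ i)"
      by (rule frechet_derivative_at[symmetric])
    then show ?thesis unfolding gradient_def by simp
  qed
  have hess: "hessian (\<lambda>x. g x $ i) y *v v = (\<chi> j. g'' y v (axis j 1) $ i)" for i
  proof -
    have "((\<lambda>x. \<chi> j. g' x (axis j 1) $ i) has_derivative (\<lambda>v. \<chi> j. g'' y v (axis j 1) $ i)) (at y)"
    proof (rule has_derivative_componentwise_within[THEN iffD2], rule ballI)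
      fix b :: "real^'m" assume "b \<in> Basis"
      then obtain j where b: "b = axis j 1" by (auto simp: Basis_vec_def)
      have "((\<lambda>x. g' x (axis j 1)) has_derivative (\<lambda>v. g'' y v (axis j 1))) (at y)"
        by (rule bounded_linear.has_derivative[OF blinfun.bounded_linear_left g''])
      from bounded_linear.has_derivative[OF bounded_linear_vec_nth this]
      show "((\<lambda>x. (\<chi> j. g' x (axis j 1) $ i) \<bullet> b) has_derivative
          (\<lambda>v. (\<chi> j. g'' y v (axis j 1) $ i) \<bullet> b)) (at y)"
        unfolding b by (simp add: inner_axis)
    qed
    then have "(gradient (\<lambda>x. g x $ i) has_derivative (\<lambda>v. \<chi> j. g'' y v (axis j 1) $ i)) (at y)"
      unfolding grad[abs_def] .
    from jacobian_mult_eq[OF this] show ?thesis unfolding hessian_def by (rule fun_cong)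
  qed
  have "(hessian (\<lambda>x. g x $ i) y *v v) \<bullet> d = g'' y v d $ i" for i
  proof -
    have "d = (\<Sum>j\<in>UNIV. d $ j *\<^sub>R axis j 1)"
      using basis_expansion[of d] by (simp add: scalar_mult_eq_scaleR)
    then have "g'' y v d = (\<Sum>j\<in>UNIV. d $ j *\<^sub>R g'' y v (axis j 1))"
      by (metis (no_types, lifting) blinfun.sum_right blinfun.scaleR_right sum.cong)
    then show ?thesis unfolding hess by (simp add: inner_vec_def mult.commute)
  qed
  then show ?thesis
    by (simp add: sum_matrix_vector_mult scaleR_matrix_vector_assoc[symmetric] inner_sum_left inner_vec_def[of \<nu>])
qed

theorem theorem3p4:
  fixes g :: "real^'m \<Rightarrow> real^'l"
    and Theta :: "(real^'l) set"
    and Gamma :: "(real^'m) set"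
    and E Xi :: "(real^'q) set"
    and ybar ubar :: "real^'m"
  assumes "C2_on g UNIV"
    and "closed Theta" and "convex Theta" and "cone Theta"
    and "Gamma = g -` Theta"
    and "ybar \<in> Gamma"
    and A1: "pointed_C2_reducible Theta (g ybar) E Xi"
    and A2: "nondegenerate g Theta ybar"
    and A3: "\<forall>z. dir_differentiable (closest_point Theta) z"
    and "ubar = ybar"
  shows "\<exists>U. open U \<and> ubar \<in> U \<and>
    (\<forall>u\<in>U. \<exists>!y. y \<in> metric_projection Gamma u) \<and>
    (\<forall>u\<in>U. let y = closest_point Gamma u in
       (\<exists>!\<nu>. lagrange_multiplier g Theta u y \<nu>) \<and>
       dir_differentiable (closest_point Gamma) u \<and>
       (\<forall>\<nu> h. lagrange_multiplier g Theta u y \<nu> \<longrightarrow>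
          (\<exists>!v. derivative_system g Theta y \<nu> h v) \<and>
          (\<forall>v. derivative_system g Theta y \<nu> h v \<longrightarrow>
             has_dir_deriv (closest_point Gamma) u h (fst v))))"
proof -
  have Gamma: "Gamma = g -` Theta" and ybar: "g ybar \<in> Theta" using assms by auto
  obtain g' :: "real^'m \<Rightarrow> (real^'m) \<Rightarrow>\<^sub>L (real^'l)" and g'' where
    g': "\<And>x. (g has_derivative blinfun_apply (g' x)) (at x)"
    and g'': "\<And>x. (g' has_derivative blinfun_apply (g'' x)) (at x)" and contg'': "continuous_on UNIV g''"
    using assms(1) unfolding C2_on_def by auto
  obtain V and \<eta> :: "real^'l \<Rightarrow> real^'q" where E: "subspace E" "Xi \<subseteq> E" "convex Xi"
    and V: "open V" "g ybar \<in> V" and C2: "C2_on \<eta> V" and \<eta>E: "\<eta> ` V \<subseteq> E"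
    and iff: "\<And>x. x \<in> V \<Longrightarrow> x \<in> Theta \<longleftrightarrow> \<eta> x \<in> Xi"
    and pt: "pointed (tangent_cone Xi (\<eta> (g ybar)))"
    and onto: "range ((*v) (jacobian \<eta> (at (g ybar)))) = E"
    using A1 unfolding pointed_C2_reducible_def by metis
  obtain \<eta>' :: "real^'l \<Rightarrow> (real^'l) \<Rightarrow>\<^sub>L (real^'q)" and \<eta>'' where
    \<eta>': "\<And>x. x \<in> V \<Longrightarrow> (\<eta> has_derivative blinfun_apply (\<eta>' x)) (at x)"
    and \<eta>'': "\<And>x. x \<in> V \<Longrightarrow> (\<eta>' has_derivative blinfun_apply (\<eta>'' x)) (at x)"
    and cont\<eta>'': "continuous_on V \<eta>''"
    using C2 unfolding C2_on_def by auto
  have jac: "jacobian g (at y) *v v = g' y v" for y v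
    using jacobian_mult_eq[OF g'] by (rule fun_cong)
  have range: "range (\<eta>' (g ybar)) = E"
    using onto unfolding jacobian_mult_eq[OF \<eta>'[OF V(2)]] .
  have cont\<eta>': "continuous_on V \<eta>'"
    using \<eta>'' by (meson has_derivative_continuous continuous_at_imp_continuous_on)
  have lin: "lin (tangent_cone Theta (g ybar)) = {d. \<eta>' (g ybar) d = 0}"
  proof (rule lin_tangent_cone[where V=V and \<Xi>=Xi])
    show "\<eta> ` V \<subseteq> range (\<eta>' (g ybar))" using \<eta>E range by simp
  qed (fact V ybar \<eta>' cont\<eta>' iff pt)+
  have nondeg: "\<exists>v d. s = g' ybar v + d \<and> \<eta>' (g ybar) d = 0" for s
  proof -
    have "s \<in> {a + b | a b. a \<in> range ((*v) (jacobian g (at ybar))) \<and> b \<in> lin (tangent_cone Theta (g ybar))}"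
      using A2 unfolding nondegenerate_def by blast
    then show ?thesis unfolding lin jac by auto
  qed
  obtain Y W K C where Y: "ybar \<in> Y" and "regular_constraint g g' g'' \<eta> \<eta>' \<eta>'' Theta Xi E Y W K C"
    using regular_constraint_near[OF assms(2,3) E(3,2,1) g' g'' contg'' V \<eta>' \<eta>'' cont\<eta>'' \<eta>E range iff nondeg]
    by blast
  then interpret regular_constraint g g' g'' \<eta> \<eta>' \<eta>'' Theta Xi E Y W K C by simp
  have dd: "\<exists>p. has_dir_deriv (closest_point Theta) z w p" for z w
    using A3 unfolding dir_differentiable_def by blast
  have "continuous_on UNIV g"
    using g' by (meson has_derivative_continuous continuous_at_imp_continuous_on)
  then have closed: "closed (g -` Theta)" by (rule closed_vimage[OF assms(2)])
  have mult: "multiplier u y \<nu> \<longleftrightarrow> lagrange_multiplier g Theta u y \<nu>" if "y \<in> Y" "g y \<in> Theta" for u y \<nu>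
  proof -
    have "u = y + transpose (jacobian g (at y)) *v \<nu> \<longleftrightarrow> (\<forall>v. (u - y) \<bullet> v = \<nu> \<bullet> g' y v)"
      unfolding jac[symmetric] inner_transpose_mult[symmetric] vector_eq_rdot by (auto simp: algebra_simps)
    moreover have "0 \<in> (\<lambda>w. - g y + w) ` normal_cone (polar_cone Theta) \<nu> \<longleftrightarrow> g y \<in> normal_cone (polar_cone Theta) \<nu>"
      by (auto simp: image_iff)
    ultimately show ?thesis
      unfolding multiplier_def lagrange_multiplier_def using that polar_normal_cone_iff[OF assms(4) that(2)] by simp
  qed
  have sys: "derivative_system g Theta y \<nu> h v \<longleftrightarrow> solves y \<nu> h v" for y \<nu> h v
  proof (cases v)
    case (Pair v1 v2)
    have "h = (mat 1 + (\<Sum>i\<in>UNIV. (\<nu> $ i) *\<^sub>R hessian (\<lambda>x. g x $ i) y)) *v v1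
           + transpose (jacobian g (at y)) *v v2 \<longleftrightarrow>
        (\<forall>d. h \<bullet> d = v1 \<bullet> d + \<nu> \<bullet> g'' y v1 d + v2 \<bullet> g' y d)"
      unfolding vector_eq_rdot[symmetric, of h]
      by (simp only: inner_add_left matrix_vector_mult_add_rdistrib matrix_vector_mul_lid
          inner_transpose_mult jac inner_hessian_combination[of g g' g'' y, OF g' g''])
    moreover obtain p where "has_dir_deriv (closest_point Theta) (g y + \<nu>) (g' y v1 + v2) p" using dd by blast
    ultimately show ?thesis
      unfolding derivative_system_def solves_def Pair by (simp add: has_dir_deriv_iff jac)
  qed
  obtain U where UR: "open U \<and> ybar \<in> U \<and> (\<forall>u\<in>U. (\<exists>!y. y \<in> metric_projection Gamma u) \<and>
     (\<exists>!\<nu>. multiplier u (closest_point Gamma u) \<nu>) \<and>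
     (\<forall>\<nu> h. multiplier u (closest_point Gamma u) \<nu> \<longrightarrow>
        (\<exists>!v. solves (closest_point Gamma u) \<nu> h v) \<and>
        (\<forall>v. solves (closest_point Gamma u) \<nu> h v \<longrightarrow>
           has_dir_deriv (closest_point Gamma) u h (fst v))))"
    using local_projection[OF dd Y ybar closed] unfolding Gamma by (rule exE)
  then have U: "open U" "ybar \<in> U" by simp_all
  note res = bspec[OF UR[THEN conjunct2, THEN conjunct2]]
  have "\<forall>\<nu>. multiplier u (closest_point Gamma u) \<nu> \<longleftrightarrow> lagrange_multiplier g Theta u (closest_point Gamma u) \<nu>"
    if u: "u \<in> U" for u
  proof -
    obtain \<nu> where "multiplier u (closest_point Gamma u) \<nu>" using res[OF u] by blast
    then have "closest_point Gamma u \<in> Y" "g (closest_point Gamma u) \<in> Theta" unfolding multiplier_def by auto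
    then show ?thesis using mult by blast
  qed
  then have res': "(\<exists>!y. y \<in> metric_projection Gamma u) \<and>
     (\<exists>!\<nu>. lagrange_multiplier g Theta u (closest_point Gamma u) \<nu>) \<and>
     (\<forall>\<nu> h. lagrange_multiplier g Theta u (closest_point Gamma u) \<nu> \<longrightarrow>
        (\<exists>!v. derivative_system g Theta (closest_point Gamma u) \<nu> h v) \<and>
        (\<forall>v. derivative_system g Theta (closest_point Gamma u) \<nu> h v \<longrightarrow>
           has_dir_deriv (closest_point Gamma) u h (fst v)))" if "u \<in> U" for u
    using res[OF that] that unfolding sys by simp
  have "dir_differentiable (closest_point Gamma) u" if "u \<in> U" for u
    unfolding dir_differentiable_def using res'[OF that] by blast
  with res' U \<open>ubar = ybar\<close> show ?thesis
    unfolding Let_def by (intro exI[of _ U]) simp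
qed

end
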